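(* When $n_{\mathrm{per}}=N$, we have $\mathbf{Z}_n^{(3)}\equiv\mathbf{0}$. When $n_{\mathrm{per}}<N$, we have $\mathbf{Z}_n^{(3)}\to\mathbf{0}$ almost surely as $n\to\infty$ if and only if $\sum_n r_n=+\infty$.
   Context: Let $N\ge 2$, $V=\{1,\dots,N\}$, and let $W=[w_{l_1,l_2}]_{l_1,l_2\in V}$ be an irreducible real matrix with non-negative entries such that $W^\top\mathbf{1}=\mathbf{1}$, where $\mathbf{1}$ is the all-ones vector ($\mathbf{0}$ is the zero vector). Let $(r_n)_{n\ge0}$ be a deterministic sequence with $0<r_n<1$. Let $\mathbf{Z}_0=[Z_{0,1},\dots,Z_{0,N}]^\top$ be a random vector with values in $[0,1]^N$ such that $P(\mathbf{Z}_0=\mathbf{0})+P(\mathbf{Z}_0=\mathbf{1})<1$ and, for $n\ge 0$, let $\mathcal{F}_n=\sigma(Z_{0,l}:l\in V)\vee\sigma(X_{k,l}:1\le k\le n,\,l\in V)$. Given $\mathcal{F}_n$, the random variables $X_{n+1,l}$, $l\in V$, are $\{0,1\}$-valued and conditionally independent with $P(X_{n+1,l}=1\mid\mathcal{F}_n)=\sum_{l_1=1}^N w_{l_1,l}Z_{n,l_1}=[W^\top\mathbf{Z}_n]_l$, and $\mathbf{Z}_{n+1}=(1-r_n)\mathbf{Z}_n+r_n\mathbf{X}_{n+1}$, where $\mathbf{X}_{n}=[X_{n,1},\dots,X_{n,N}]^\top$, $\mathbf{Z}_{n}=[Z_{n,1},\dots,Z_{n,N}]^\top$. Let $n_{\mathrm{per}}\ge1$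 be the period of the irreducible matrix $W^\top$ ($\gcd\{k\ge1:[(W^\top)^k]_{l,l}>0\}$, independent of $l$). The set $V$ is partitioned into $n_{\mathrm{per}}$ cyclic classes, numbered $0,\dots,n_{\mathrm{per}}-1$ (numbers modulo $n_{\mathrm{per}}$), such that $[W^\top]_{l_1,l_2}=0$ when $l_1$ is in class $h$ and $l_2$ is not in class $h+1$; they are the communicating classes of $(W^\top)^{n_{\mathrm{per}}}$. Write $l_1\sim_c l_2$ if $l_1,l_2$ are in the same cyclic class. Let $\mathbf{v}$ be the unique vector with strictly positive entries with $\mathbf{v}^\top W^\top=\mathbf{v}^\top$ and $\mathbf{v}^\top\mathbf{1}=1$. Decomposition $\mathbf{Z}_n=\mathbf{Z}_n^{(1)}+\mathbf{Z}_n^{(2)}+\mathbf{Z}_n^{(3)}$: set $\widetilde Z_n=\mathbf{v}^\top\mathbf{Z}_n$, $\mathbf{Z}_n^{(1)}=\widetilde Z_n\mathbf{1}$; set $Z_{n,l}^{(C)}=\sum_{l_1\sim_c l}\frac{v_{l_1}}{\sum_{l_2\sim_c l}v_{l_2}}Z_{n,l_1}$ for $l\in V$ and $\mathbf{Z}_n^{(2)}=\mathbf{Z}_n^{(C)}-\widetilde Z_n\mathbf{1}$; finally $\mathbf{Z}_n^{(3)}=\mathbf{Z}_n-\mathbf{Z}_n^{(1)}-\mathbf{Z}_n^{(2)}$. *)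

theory Defs
  imports "HOL-Probability.Probability"
begin

definition matpow :: "real ^ 'n ^ 'n \<Rightarrow> nat \<Rightarrow> real ^ 'n ^ 'n" where
  "matpow A k = (((**) A) ^^ k) (mat 1)"

definition nonneg_mat :: "real ^ 'n ^ 'n \<Rightarrow> bool" where
  "nonneg_mat A \<longleftrightarrow> (\<forall>i j. 0 \<le> A $ i $ j)"

definition irreducible_mat :: "real ^ 'n ^ 'n \<Rightarrow> bool" where
  "irreducible_mat A \<longleftrightarrow> (\<forall>i j. \<exists>k\<ge>1. 0 < matpow A k $ i $ j)"

definition period_at :: "real ^ 'n ^ 'n \<Rightarrow> 'n \<Rightarrow> nat" where
  "period_at A l = Gcd {k. 1 \<le> k \<and> 0 < matpow A k $ l $ l}"

text \<open>For an irreducible non-negative matrix the period does not depend on the state; see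
  \<open>period_at_eq_period\<close> below.\<close>

definition period :: "real ^ 'n ^ 'n \<Rightarrow> nat" where
  "period A = (THE d. \<forall>l. period_at A l = d)"

text \<open>A numbering of the cyclic classes: \<open>cls l\<close> is the number of the class of \<open>l\<close>, and two states
  are in the same class iff their numbers agree. Existence of such a numbering, and the fact that its
  classes are the communicating classes of the power \<open>period A\<close> of \<open>A\<close> (so that they do not depend
  on the numbering), are shown in \<open>cyclic_classes_exists\<close> and \<open>cyclic_classes_iff\<close>.\<close>

definition cyclic_classes :: "real ^ 'n ^ 'n \<Rightarrow> ('n \<Rightarrow> nat) \<Rightarrow> bool" where
  "cyclic_classes A cls \<longleftrightarrow>
     range cls = {0..<period A} \<and>
     (\<forall>i j. cls j \<noteq> (cls i + 1) mod period A \<longrightarrow> A $ i $ j = 0)"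

lemma matpow_0: "matpow A 0 = mat 1"
  by (simp add: matpow_def)

lemma matpow_Suc: "matpow A (Suc k) = A ** matpow A k"
  by (simp add: matpow_def)

lemma matpow_add: "matpow A (m + k) = matpow A m ** matpow A k"
  by (induction m) (simp_all add: matpow_0 matpow_Suc matrix_mul_assoc)

lemma matpow_1: "matpow A 1 = A"
  by (simp add: matpow_def)

lemma matpow_mult: "matpow (matpow A d) k = matpow A (d * k)"
  by (induction k) (simp_all add: matpow_0 matpow_Suc matpow_add)

lemma nonneg_mat_mult:
  assumes "nonneg_mat A" "nonneg_mat B"
  shows "nonneg_mat (A ** B)"
  using assms by (auto simp: nonneg_mat_def matrix_matrix_mult_def intro!: sum_nonneg)

lemma nonneg_matpow: "nonneg_mat A \<Longrightarrow> nonneg_mat (matpow A k)"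
proof (induction k)
  case 0
  then show ?case by (simp add: matpow_0 nonneg_mat_def mat_def)
next
  case (Suc k)
  then show ?case by (simp add: matpow_Suc nonneg_mat_mult)
qed

lemma matrix_mult_pos_iff:
  fixes A B :: "real ^ 'n ^ 'n"
  assumes "nonneg_mat A" "nonneg_mat B"
  shows "0 < (A ** B) $ i $ j \<longleftrightarrow> (\<exists>k. 0 < A $ i $ k \<and> 0 < B $ k $ j)"
proof -
  have nn: "0 \<le> A $ i $ k * B $ k $ j" for k
    using assms by (simp add: nonneg_mat_def)
  have "0 < (A ** B) $ i $ j \<longleftrightarrow> (\<Sum>k\<in>UNIV. A $ i $ k * B $ k $ j) \<noteq> 0"
    using nn sum_nonneg[of UNIV "\<lambda>k. A $ i $ k * B $ k $ j"]
    by (auto simp: matrix_matrix_mult_def less_le)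
  also have "\<dots> \<longleftrightarrow> (\<exists>k. A $ i $ k * B $ k $ j \<noteq> 0)"
    using nn by (subst sum_nonneg_eq_0_iff) auto
  also have "\<dots> \<longleftrightarrow> (\<exists>k. 0 < A $ i $ k \<and> 0 < B $ k $ j)"
    using assms by (auto simp: nonneg_mat_def less_le)
  finally show ?thesis .
qed

lemma matpow_pos_add:
  assumes "nonneg_mat A" "0 < matpow A m $ i $ j" "0 < matpow A k $ j $ l"
  shows "0 < matpow A (m + k) $ i $ l"
  using assms by (auto simp: matpow_add matrix_mult_pos_iff nonneg_matpow)

lemma irreducible_matE:
  assumes "irreducible_mat A"
  obtains k where "1 \<le> k" "0 < matpow A k $ i $ j"
  using assms unfolding irreducible_mat_def by blast

lemma period_at_dvd: "0 < matpow A k $ l $ l \<Longrightarrow> period_at A l dvd k"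
  by (cases "k = 0") (simp_all add: period_at_def)

lemma period_at_eq_period:
  assumes "nonneg_mat A" "irreducible_mat A"
  shows "period_at A l = period A"
proof -
  have dvd: "period_at A i dvd period_at A j" for i j
  proof -
    obtain p where p: "0 < matpow A p $ i $ j"
      by (rule irreducible_matE[OF assms(2)])
    obtain q where q: "0 < matpow A q $ j $ i"
      by (rule irreducible_matE[OF assms(2)])
    have pq: "period_at A i dvd p + q"
      by (intro period_at_dvd matpow_pos_add[OF assms(1) p q])
    have "period_at A i dvd k" if k: "0 < matpow A k $ j $ j" for k
    proof -
      have "0 < matpow A (p + k + q) $ i $ i"
        by (intro matpow_pos_add[OF assms(1) matpow_pos_add[OF assms(1) p k] q])
      then have "period_at A i dvd p + k + q" by (rule period_at_dvd)
      then have "period_at A i dvd (p + q) + k" by (simp add: ac_simps)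
      with pq show ?thesis by (simp add: dvd_add_right_iff)
    qed
    then show ?thesis by (subst (2) period_at_def) (auto intro: Gcd_greatest)
  qed
  then have eq: "period_at A i = period_at A l" for i by (intro dvd_antisym)
  show ?thesis
    unfolding period_def
  proof (rule the_equality[symmetric])
    show "\<forall>i. period_at A i = period_at A l" using eq by (intro allI)
  next
    fix d assume "\<forall>i. period_at A i = d"
    then have "period_at A l = d" by (rule spec)
    then show "d = period_at A l" by (rule sym)
  qed
qed

lemma period_pos:
  assumes "nonneg_mat A" "irreducible_mat A"
  shows "0 < period A"
proof -
  fix l
  obtain k where "k \<ge> 1" "0 < matpow A k $ l $ l"
    by (rule irreducible_matE[OF assms(2)])
  then have "period A dvd k" "k \<noteq> 0"
    using period_at_dvd[of A k l] by (simp_all add: period_at_eq_period[OF assms])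
  then show ?thesis by (auto intro!: Nat.gr0I)
qed

lemma period_dvd:
  assumes "nonneg_mat A" "irreducible_mat A" "0 < matpow A k $ l $ l"
  shows "period A dvd k"
  using period_at_dvd[OF assms(3)] period_at_eq_period[OF assms(1,2)] by simp

lemma cyclic_classes_matpow:
  assumes "nonneg_mat A" "irreducible_mat A" "cyclic_classes A cls" "0 < matpow A k $ i $ j"
  shows "cls j = (cls i + k) mod period A"
  using assms(4)
proof (induction k arbitrary: i)
  case 0
  have "cls i < period A" using assms(3) by (auto simp: cyclic_classes_def)
  with 0 show ?case by (auto simp: matpow_0 mat_def split: if_splits)
next
  case (Suc k)
  then obtain m where m: "0 < A $ i $ m" "0 < matpow A k $ m $ j"
    using assms(1) by (auto simp: matpow_Suc matrix_mult_pos_iff nonneg_matpow)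
  then have "cls m = (cls i + 1) mod period A"
    using assms(3) unfolding cyclic_classes_def by fastforce
  with Suc.IH[OF m(2)] show ?case by (simp add: mod_simps)
qed

lemma cyclic_classes_exists:
  fixes A :: "real ^ 'n ^ 'n"
  assumes "nonneg_mat A" "irreducible_mat A"
  shows "\<exists>cls. cyclic_classes A cls"
proof -
  fix s :: 'n
  define t where "t j = (SOME k. 0 < matpow A k $ s $ j)" for j
  define cls where "cls j = t j mod period A" for j
  have t: "0 < matpow A (t j) $ s $ j" for j
    unfolding t_def by (rule irreducible_matE[OF assms(2)]) (rule someI)
  have cls: "cls j = k mod period A" if k: "0 < matpow A k $ s $ j" for j k
  proof -
    obtain q where q: "0 < matpow A q $ j $ s"
      by (rule irreducible_matE[OF assms(2)])
    have "period A dvd t j + q" "period A dvd k + q"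
      by (rule period_dvd[OF assms matpow_pos_add[OF assms(1) t q]])
         (rule period_dvd[OF assms matpow_pos_add[OF assms(1) k q]])
    then have "period A dvd t j - k" "period A dvd k - t j"
      using dvd_diff_nat[of "period A" "t j + q" "k + q"]
            dvd_diff_nat[of "period A" "k + q" "t j + q"] by simp_all
    then show ?thesis
      using mod_eq_dvd_iff_nat[of k "t j" "period A"] mod_eq_dvd_iff_nat[of "t j" k "period A"]
        nat_le_linear[of k "t j"] unfolding cls_def by argo
  qed
  have ex: "\<exists>j. 0 < matpow A k $ s $ j" for k
  proof (induction k)
    case 0
    then show ?case by (intro exI[of _ s]) (simp add: matpow_0 mat_def)
  next
    case (Suc k)
    then obtain j where j: "0 < matpow A k $ s $ j" by auto
    obtain p where "p \<ge> 1" "0 < matpow A p $ j $ j"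
      by (rule irreducible_matE[OF assms(2)])
    then obtain m where "0 < A $ j $ m"
      using assms(1) by (cases p) (auto simp: matpow_Suc matrix_mult_pos_iff nonneg_matpow)
    then have "0 < matpow A (k + 1) $ s $ m"
      using j by (intro matpow_pos_add[OF assms(1) j]) (simp only: matpow_1)
    then show ?case by auto
  qed
  have "range cls = {0..<period A}"
  proof (intro equalityI subsetI)
    fix h assume "h \<in> {0..<period A}"
    moreover obtain j where "0 < matpow A h $ s $ j" using ex by blast
    ultimately have "h = cls j" using cls by simp
    then show "h \<in> range cls" by blast
  qed (auto simp: cls_def period_pos[OF assms])
  moreover have "A $ i $ j = 0" if "cls j \<noteq> (cls i + 1) mod period A" for i j
  proof (rule ccontr)
    assume "A $ i $ j \<noteq> 0"
    then have "0 < A $ i $ j" using assms(1) by (simp add: nonneg_mat_def less_le)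
    then have "0 < matpow A (t i + 1) $ s $ j"
      by (intro matpow_pos_add[OF assms(1) t]) (simp only: matpow_1)
    from cls[OF this] that show False by (simp add: cls_def mod_simps)
  qed
  ultimately show ?thesis unfolding cyclic_classes_def by blast
qed

lemma cyclic_classes_iff:
  assumes "nonneg_mat A" "irreducible_mat A" "cyclic_classes A cls"
  shows "cls i = cls j \<longleftrightarrow> (\<exists>k. 0 < matpow (matpow A (period A)) k $ i $ j)"
proof
  have lt: "cls l < period A" for l using assms(3) by (auto simp: cyclic_classes_def)
  assume eq: "cls i = cls j"
  obtain k where k: "0 < matpow A k $ i $ j"
    by (rule irreducible_matE[OF assms(2)])
  from cyclic_classes_matpow[OF assms k] have "(cls i + k) mod period A = (cls i + 0) mod period A"
    using eq lt by simp
  then have "period A dvd k"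
    using mod_eq_dvd_iff_nat[of "cls i" "cls i + k" "period A"] by simp
  with k show "\<exists>k. 0 < matpow (matpow A (period A)) k $ i $ j"
    by (auto simp: matpow_mult)
next
  have lt: "cls l < period A" for l using assms(3) by (auto simp: cyclic_classes_def)
  assume "\<exists>k. 0 < matpow (matpow A (period A)) k $ i $ j"
  then obtain k where "0 < matpow A (period A * k) $ i $ j" by (auto simp: matpow_mult)
  from cyclic_classes_matpow[OF assms this] show "cls i = cls j" using lt by simp
qed

definition hist_algebra ::
  "'a measure \<Rightarrow> (nat \<Rightarrow> 'a \<Rightarrow> real ^ 'n) \<Rightarrow> (nat \<Rightarrow> 'a \<Rightarrow> real ^ 'n) \<Rightarrow> nat \<Rightarrow> 'a measure" where
  "hist_algebra M Z X n = sigma (space M)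
     ({(\<lambda>\<omega>. Z 0 \<omega> $ l) -` B \<inter> space M | l B. B \<in> sets borel} \<union>
      {(\<lambda>\<omega>. X k \<omega> $ l) -` B \<inter> space M | k l B. 1 \<le> k \<and> k \<le> n \<and> B \<in> sets borel})"

definition cprob :: "'a measure \<Rightarrow> 'a measure \<Rightarrow> 'a set \<Rightarrow> 'a \<Rightarrow> real" where
  "cprob M F E = real_cond_exp M F (indicator E)"

definition cond_indep_vars ::
  "'a measure \<Rightarrow> 'a measure \<Rightarrow> ('i \<Rightarrow> 'b measure) \<Rightarrow> ('i \<Rightarrow> 'a \<Rightarrow> 'b) \<Rightarrow> 'i set \<Rightarrow> bool" where
  "cond_indep_vars M F M' X I \<longleftrightarrow>
     (\<forall>i\<in>I. X i \<in> measurable M (M' i)) \<and>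
     (\<forall>J\<subseteq>I. J \<noteq> {} \<longrightarrow> finite J \<longrightarrow> (\<forall>B\<in>(\<Pi> j\<in>J. sets (M' j)).
        AE \<omega> in M. cprob M F {\<omega>\<in>space M. \<forall>j\<in>J. X j \<omega> \<in> B j} \<omega> =
                   (\<Prod>j\<in>J. cprob M F {\<omega>\<in>space M. X j \<omega> \<in> B j} \<omega>)))"

text \<open>\<open>real_cond_exp M F\<close> is a genuine conditional expectation only when \<open>F\<close> is a sub-sigma-algebra
  of \<open>M\<close>.\<close>

lemma subalgebra_hist_algebra:
  assumes "Z 0 \<in> borel_measurable M" "\<And>k. 1 \<le> k \<Longrightarrow> X k \<in> borel_measurable M"
  shows "subalgebra M (hist_algebra M Z X n)"
proof -
  have nth: "(\<lambda>\<omega>. f \<omega> $ l) \<in> borel_measurable M"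
    if "f \<in> borel_measurable M" for f :: "_ \<Rightarrow> real ^ 'm" and l
    using that
    by (rule measurable_compose) (rule borel_measurable_nth)
  show ?thesis
    unfolding subalgebra_def hist_algebra_def
  proof (intro conjI, simp add: space_measure_of_conv, subst sets_measure_of)
    show "sigma_sets (space M)
       ({(\<lambda>\<omega>. Z 0 \<omega> $ l) -` B \<inter> space M | l B. B \<in> sets borel} \<union>
        {(\<lambda>\<omega>. X k \<omega> $ l) -` B \<inter> space M | k l B. 1 \<le> k \<and> k \<le> n \<and> B \<in> sets borel}) \<subseteq> sets M"
      by (intro sets.sigma_sets_subset)
         (auto intro!: measurable_sets[OF nth[OF assms(1)]] measurable_sets[OF nth[OF assms(2)]])
  qed auto
qed

definition Ztilde :: "real ^ 'n \<Rightarrow> real ^ 'n \<Rightarrow> real" where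
  "Ztilde v z = v \<bullet> z"

definition Zpart1 :: "real ^ 'n \<Rightarrow> real ^ 'n \<Rightarrow> real ^ 'n" where
  "Zpart1 v z = Ztilde v z *\<^sub>R 1"

definition Zclass :: "('n \<Rightarrow> nat) \<Rightarrow> real ^ 'n \<Rightarrow> real ^ 'n \<Rightarrow> real ^ 'n" where
  "Zclass cls v z = (\<chi> l. \<Sum>l\<^sub>1 | cls l\<^sub>1 = cls l. v $ l\<^sub>1 / (\<Sum>l\<^sub>2 | cls l\<^sub>2 = cls l. v $ l\<^sub>2) * z $ l\<^sub>1)"

definition Zpart2 :: "('n \<Rightarrow> nat) \<Rightarrow> real ^ 'n \<Rightarrow> real ^ 'n \<Rightarrow> real ^ 'n" where
  "Zpart2 cls v z = Zclass cls v z - Ztilde v z *\<^sub>R 1"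

definition Zpart3 :: "('n \<Rightarrow> nat) \<Rightarrow> real ^ 'n \<Rightarrow> real ^ 'n \<Rightarrow> real ^ 'n" where
  "Zpart3 cls v z = z - Zpart1 v z - Zpart2 cls v z"

end

theory Submission
  imports Defs
begin

text \<open>Write \<open>P\<close> for the transpose of \<open>W\<close>. Then \<open>Z\<^sub>n\<^sub>+\<^sub>1 = (1 - r\<^sub>n) Z\<^sub>n + r\<^sub>n P Z\<^sub>n + r\<^sub>n D\<^sub>n\<close> with martingale
  differences \<open>D\<^sub>n\<close>, and the third component tends to \<open>0\<close> iff the oscillation of \<open>Z\<^sub>n\<close> inside the cyclic
  classes does. No condition on the squares of the \<open>r\<^sub>n\<close> is needed to sum the noise: the weighted mean
  is a bounded martingale whose quadratic variation dominates that of every coordinate, so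
  \<open>\<Sum> r\<^sub>n D\<^sub>n\<close> converges almost surely. As \<open>P\<close> contracts a seminorm equivalent to the oscillation,
  divergence of \<open>\<Sum> r\<^sub>n\<close> forces the oscillation to \<open>0\<close>.

  Conversely, if \<open>\<Sum> r\<^sub>n\<close> converges and the oscillation vanishes in the limit, then it vanishes
  at every late time. Two distinct nodes of one class then draw equal values independently of each other,
  so these draws are deterministic; this spreads along the arcs of \<open>P\<close> to all nodes and then backwards
  in time to \<open>Z\<^sub>0\<close>, which would be \<open>0\<close> or \<open>1\<close> almost surely.\<close>

section \<open>Contracting scalar recursions\<close>

text \<open>Once \<open>b n\<close> stays below \<open>c * (e / 2)\<close>, the level
  \<open>e / 2\<close> is preserved by the recursion, and the excess over it is multiplied by at
  most \<open>1 - c * r n\<close>, hence by at most \<open>exp (- c * r n)\<close>. Divergence of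
  the sum sends the product of these factors to 0.\<close>

lemma contraction_recursion_tendsto_0:
  fixes a b r :: "nat \<Rightarrow> real"
  assumes c: "0 < c" "c \<le> 1"
    and r: "\<And>n. 0 < r n \<and> r n < 1"
    and div: "filterlim (\<lambda>n. \<Sum>k<n. r k) at_top sequentially"
    and a: "\<And>n. 0 \<le> a n"
    and rec: "\<And>n. a (Suc n) \<le> (1 - c * r n) * a n + r n * b n"
    and b: "b \<longlonglongrightarrow> 0"
  shows "a \<longlonglongrightarrow> 0"
proof (rule LIMSEQ_I)
  fix e :: real assume e: "0 < e"
  have "eventually (\<lambda>n. b n < c * (e / 2)) sequentially"
    by (rule order_tendstoD(2)[OF b]) (use c e in simp)
  then obtain n0 where n0: "\<And>n. n \<ge> n0 \<Longrightarrow> b n < c * (e / 2)"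
    by (auto simp: eventually_sequentially)
  define R where "R n = (\<Sum>k<n. r k)" for n
  have bound: "a n \<le> e / 2 + a n0 * exp (- c * (R n - R n0))" if "n \<ge> n0" for n
    using that
  proof (induction n rule: dec_induct)
    case base
    then show ?case using e by simp
  next
    case (step n)
    have le1: "c * r n \<le> 1" using mult_mono[of c 1 "r n" 1] c r[of n] by simp
    have ex: "1 - c * r n \<le> exp (- (c * r n))" using exp_ge_add_one_self[of "- (c * r n)"] by simp
    have "a (Suc n) \<le> (1 - c * r n) * a n + r n * (c * (e / 2))"
      using rec[of n] n0[of n] step(1) r[of n] by (smt (verit) mult_left_mono)
    also have "\<dots> \<le> (1 - c * r n) * (e / 2 + a n0 * exp (- c * (R n - R n0))) + r n * (c * (e / 2))"
      using step.IH le1 by (intro add_right_mono mult_left_mono) auto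
    also have "\<dots> = e / 2 + (1 - c * r n) * (a n0 * exp (- c * (R n - R n0)))"
      by (simp add: algebra_simps)
    also have "\<dots> \<le> e / 2 + exp (- (c * r n)) * (a n0 * exp (- c * (R n - R n0)))"
      using ex a[of n0] by (intro add_left_mono mult_right_mono) auto
    also have "\<dots> = e / 2 + a n0 * exp (- c * (R (Suc n) - R n0))"
      by (simp add: R_def exp_add[symmetric] algebra_simps)
    finally show ?case .
  qed
  have "filterlim (\<lambda>n. - c * (R n - R n0)) at_bot sequentially"
  proof (rule filterlim_tendsto_neg_mult_at_bot[OF tendsto_const])
    show "filterlim (\<lambda>n. R n - R n0) at_top sequentially"
      using filterlim_tendsto_add_at_top[OF tendsto_const[of "- R n0"] div]
      by (simp add: R_def)
  qed (use c in simp)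
  then have "(\<lambda>n. a n0 * exp (- c * (R n - R n0))) \<longlonglongrightarrow> a n0 * 0"
    by (intro tendsto_mult tendsto_const filterlim_compose[OF exp_at_bot])
  then have "eventually (\<lambda>n. a n0 * exp (- c * (R n - R n0)) < e / 2) sequentially"
    using e by (intro order_tendstoD(2)) auto
  then have "eventually (\<lambda>n. a n < e) sequentially"
    using eventually_ge_at_top[of n0]
  proof eventually_elim
    case (elim n)
    then show ?case using bound[of n] by simp
  qed
  then show "\<exists>n0. \<forall>n\<ge>n0. norm (a n - 0) < e"
    using a by (auto simp: eventually_sequentially)
qed

section \<open>Almost sure convergence of series of bounded martingale differences\<close>

text \<open>\<open>orth\<close> is the martingale difference property in weak form:
  \<open>d n\<close> is revealed at time \<open>Suc n\<close> and integrates to 0 against every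
  bounded function of the past up to \<open>n\<close>. The estimates below thus need integrals
  only.\<close>

locale orthogonal_increments = prob_space M for M :: "'a measure" +
  fixes F :: "nat \<Rightarrow> 'a measure" and d :: "nat \<Rightarrow> 'a \<Rightarrow> real" and B :: real
  assumes sub: "subalgebra M (F n)"
    and mono: "m \<le> n \<Longrightarrow> sets (F m) \<subseteq> sets (F n)"
    and d: "d n \<in> borel_measurable (F (Suc n))"
    and bnd: "\<omega> \<in> space M \<Longrightarrow> \<bar>d n \<omega>\<bar> \<le> B"
    and orth: "g \<in> borel_measurable (F n) \<Longrightarrow> (\<And>\<omega>. \<omega> \<in> space M \<Longrightarrow> \<bar>g \<omega>\<bar> \<le> C) \<Longrightarrow>
                 (\<integral>\<omega>. g \<omega> * d n \<omega> \<partial>M) = 0"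
begin

lemma meas_mono: "f \<in> borel_measurable (F i) \<Longrightarrow> i \<le> j \<Longrightarrow> f \<in> borel_measurable (F j)"
  for f :: "'a \<Rightarrow> real"
  by (rule measurable_from_subalg[of _ "F i"]) (use sub mono in \<open>auto simp: subalgebra_def\<close>)

lemma meas_M: "f \<in> borel_measurable (F i) \<Longrightarrow> f \<in> borel_measurable M" for f :: "'a \<Rightarrow> real"
  by (rule measurable_from_subalg[OF sub])

text \<open>The weights \<open>H\<close> are predictable, as a stopping rule is. In the square of
  the weighted sum the cross terms vanish by \<open>orth\<close>, and each remaining square only
  shrinks under a weight of modulus at most 1.\<close>

lemma sum_square:
  assumes H: "\<And>k. m \<le> k \<Longrightarrow> H k \<in> borel_measurable (F k)"
    and H01: "\<And>k \<omega>. \<bar>H k \<omega>\<bar> \<le> 1"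
  shows "(\<integral>\<omega>. (\<Sum>k=m..<n. H k \<omega> * d k \<omega>)\<^sup>2 \<partial>M) \<le> (\<Sum>k=m..<n. (\<integral>\<omega>. (d k \<omega>)\<^sup>2 \<partial>M))"
    and "integrable M (\<lambda>\<omega>. (\<Sum>k=m..<n. H k \<omega> * d k \<omega>)\<^sup>2)"
proof -
  define V where "V n \<omega> = (\<Sum>k=m..<n. H k \<omega> * d k \<omega>)" for n \<omega>
  have VF: "V n \<in> borel_measurable (F n)" for n
    unfolding V_def
  proof (intro borel_measurable_sum borel_measurable_times)
    fix k assume "k \<in> {m..<n}"
    then show "H k \<in> borel_measurable (F n)" "d k \<in> borel_measurable (F n)"
      using meas_mono[OF H] meas_mono[OF d] by auto
  qed
  obtain \<omega>0 where "\<omega>0 \<in> space M" using not_empty by blast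
  then have B: "0 \<le> B" using bnd[of \<omega>0 0] by linarith
  have Hd: "\<bar>H k \<omega> * d k \<omega>\<bar> \<le> B" if "\<omega> \<in> space M" for k \<omega>
    using mult_mono[OF H01[of k \<omega>] bnd[OF that, of k]] by (simp add: abs_mult)
  have VB: "\<bar>V n \<omega>\<bar> \<le> real (n - m) * B" if "\<omega> \<in> space M" for n \<omega>
  proof -
    have "\<bar>V n \<omega>\<bar> \<le> (\<Sum>k=m..<n. \<bar>H k \<omega> * d k \<omega>\<bar>)" unfolding V_def by (rule sum_abs)
    also have "\<dots> \<le> real (card {m..<n}) * B" by (rule sum_bounded_above) (use Hd that in auto)
    finally show ?thesis by simp
  qed
  have int: "integrable M f" if "f \<in> borel_measurable M" "\<And>\<omega>. \<omega> \<in> space M \<Longrightarrow> \<bar>f \<omega>\<bar> \<le> C"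
    for f :: "'a \<Rightarrow> real" and C
    using that by (intro integrable_const_bound[of _ C]) auto
  have sq: "\<bar>x\<^sup>2\<bar> \<le> C\<^sup>2" if "\<bar>x\<bar> \<le> C" for x C :: real
    using power_mono[OF that, of 2] by simp
  have iV: "integrable M (\<lambda>\<omega>. (V n \<omega>)\<^sup>2)" for n
    by (rule int[OF _ sq[OF VB]]) (use meas_M[OF VF] in auto)
  have id: "integrable M (\<lambda>\<omega>. (d n \<omega>)\<^sup>2)" for n
    by (rule int[OF _ sq[OF bnd]]) (use meas_M[OF d] in auto)
  show "integrable M (\<lambda>\<omega>. (\<Sum>k=m..<n. H k \<omega> * d k \<omega>)\<^sup>2)"
    using iV unfolding V_def .
  have "(\<integral>\<omega>. (V n \<omega>)\<^sup>2 \<partial>M) \<le> (\<Sum>k=m..<n. (\<integral>\<omega>. (d k \<omega>)\<^sup>2 \<partial>M))"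
  proof (induction n)
    case 0
    then show ?case by (simp add: V_def)
  next
    case (Suc n)
    show ?case
    proof (cases "m \<le> n")
      case False
      then show ?thesis by (simp add: V_def)
    next
      case True
      have VS: "V (Suc n) \<omega> = V n \<omega> + H n \<omega> * d n \<omega>" for \<omega> using True by (simp add: V_def)
      have Hm: "H n \<in> borel_measurable M" using meas_M[OF H[OF True]] .
      have iHd: "integrable M (\<lambda>\<omega>. (H n \<omega> * d n \<omega>)\<^sup>2)"
        by (rule int[OF _ sq[OF Hd]]) (use Hm meas_M[OF d] in auto)
      have VH: "\<bar>V n \<omega> * H n \<omega>\<bar> \<le> real (n - m) * B" if "\<omega> \<in> space M" for \<omega>
        using mult_mono[OF VB[OF that, of n] H01[of n \<omega>]] B by (simp add: abs_mult)
      have VHd: "\<bar>V n \<omega> * H n \<omega> * d n \<omega>\<bar> \<le> real (n - m) * B * B" if "\<omega> \<in> space M" for \<omega>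
        using mult_mono[OF VH[OF that] bnd[OF that]] B by (simp add: abs_mult)
      have iVHd: "integrable M (\<lambda>\<omega>. V n \<omega> * H n \<omega> * d n \<omega>)"
        by (rule int[OF _ VHd]) (use Hm meas_M[OF d] meas_M[OF VF] in auto)
      have z: "(\<integral>\<omega>. V n \<omega> * H n \<omega> * d n \<omega> \<partial>M) = 0"
        by (rule orth[OF _ VH]) (use VF H[OF True] in auto)
      have "(\<integral>\<omega>. (V (Suc n) \<omega>)\<^sup>2 \<partial>M) =
            (\<integral>\<omega>. (V n \<omega>)\<^sup>2 + 2 * (V n \<omega> * H n \<omega> * d n \<omega>) + (H n \<omega> * d n \<omega>)\<^sup>2 \<partial>M)"
        by (intro Bochner_Integration.integral_cong refl)
           (simp add: VS power2_eq_square algebra_simps)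
      also have "\<dots> = (\<integral>\<omega>. (V n \<omega>)\<^sup>2 \<partial>M) + (\<integral>\<omega>. (H n \<omega> * d n \<omega>)\<^sup>2 \<partial>M)"
        using iV iVHd iHd z by simp
      also have "(\<integral>\<omega>. (H n \<omega> * d n \<omega>)\<^sup>2 \<partial>M) \<le> (\<integral>\<omega>. (d n \<omega>)\<^sup>2 \<partial>M)"
        using H01[of n] iHd id
        by (intro integral_mono) (auto simp: power_mult_distrib abs_square_le_1 intro!: mult_left_le_one_le)
      finally show ?thesis using Suc True by simp
    qed
  qed
  then show "(\<integral>\<omega>. (\<Sum>k=m..<n. H k \<omega> * d k \<omega>)\<^sup>2 \<partial>M) \<le> (\<Sum>k=m..<n. (\<integral>\<omega>. (d k \<omega>)\<^sup>2 \<partial>M))"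
    unfolding V_def .
qed


text \<open>Kolmogorov's inequality: the sum is stopped when it first reaches \<open>e\<close> in
  modulus, and Markov's inequality is applied to the square of the stopped sum, whose mean
  \<open>sum_square\<close> bounds.\<close>

lemma maximal_inequality:
  assumes "0 < e"
  shows "measure M {\<omega>\<in>space M. \<exists>k\<in>{m..n}. e \<le> \<bar>\<Sum>i=m..<k. d i \<omega>\<bar>}
           \<le> (\<Sum>k=m..<n. (\<integral>\<omega>. (d k \<omega>)\<^sup>2 \<partial>M)) / e\<^sup>2"
proof -
  define S where "S k \<omega> = (\<Sum>i=m..<k. d i \<omega>)" for k \<omega>
  \<comment> \<open>\<open>S k\<close> contains the increments before \<open>k\<close> only, so the
    decision whether to add \<open>d k\<close> is known at time \<open>k\<close>.\<close>
  define H where "H k \<omega> = (if \<forall>i\<in>{m..k}. \<bar>S i \<omega>\<bar> < e then 1 else 0 :: real)" for k \<omega>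
  have S: "S k \<in> borel_measurable (F n)" if "k \<le> n" for k n
    unfolding S_def by (intro borel_measurable_sum meas_mono[OF d]) (use that in auto)
  have SM: "S k \<in> borel_measurable M" for k
    by (rule meas_M[OF S[OF order_refl]])
  have H: "H k \<in> borel_measurable (F k)" for k
  proof -
    have [measurable]: "S i \<in> borel_measurable (F k)" if "i \<in> {m..k}" for i
      using that by (intro S) auto
    show ?thesis unfolding H_def by measurable
  qed
  have H01: "\<bar>H k \<omega>\<bar> \<le> 1" for k \<omega> by (simp add: H_def)
  define V where "V \<omega> = (\<Sum>k=m..<n. H k \<omega> * d k \<omega>)" for \<omega>
  note V = sum_square[where H = H and m = m and n = n, OF H H01, folded V_def]
  have stop: "e\<^sup>2 \<le> (V \<omega>)\<^sup>2" if ex: "\<exists>k\<in>{m..n}. e \<le> \<bar>S k \<omega>\<bar>" for \<omega>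
  proof -
    \<comment> \<open>At the passage time \<open>t\<close> the weights have let through exactly the
      increments before \<open>t\<close>, so the stopped sum \<open>V\<close> equals
      \<open>S t\<close>.\<close>
    define t where "t = (LEAST k. m \<le> k \<and> e \<le> \<bar>S k \<omega>\<bar>)"
    obtain k where k: "m \<le> k" "k \<le> n" "e \<le> \<bar>S k \<omega>\<bar>" using ex by auto
    have t: "m \<le> t" "e \<le> \<bar>S t \<omega>\<bar>"
      using LeastI[of "\<lambda>k. m \<le> k \<and> e \<le> \<bar>S k \<omega>\<bar>" k] k by (auto simp: t_def)
    have tn: "t \<le> n" using Least_le[of "\<lambda>k. m \<le> k \<and> e \<le> \<bar>S k \<omega>\<bar>" k] k by (auto simp: t_def)
    have before: "\<bar>S i \<omega>\<bar> < e" if "m \<le> i" "i < t" for i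
      using not_less_Least[of i "\<lambda>k. m \<le> k \<and> e \<le> \<bar>S k \<omega>\<bar>"] that by (auto simp: t_def)
    have Hk: "H k \<omega> = (if k < t then 1 else 0)" if "m \<le> k" for k
      using t before that by (force simp: H_def not_less)
    have "V \<omega> = (\<Sum>k=m..<n. if k < t then d k \<omega> else 0)"
      unfolding V_def by (intro sum.cong) (auto simp: Hk)
    also have "\<dots> = (\<Sum>k=m..<t. d k \<omega>)"
      by (intro sum.mono_neutral_cong_right) (use tn in auto)
    finally have "e \<le> \<bar>V \<omega>\<bar>" using t by (simp add: S_def)
    then show ?thesis using \<open>0 < e\<close> power_mono[of e "\<bar>V \<omega>\<bar>" 2] by simp
  qed
  have "measure M {\<omega>\<in>space M. \<exists>k\<in>{m..n}. e \<le> \<bar>S k \<omega>\<bar>} \<le> measure M {\<omega>\<in>space M. e\<^sup>2 \<le> (V \<omega>)\<^sup>2}"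
    using stop borel_measurable_integrable[OF V(2)] by (intro finite_measure_mono) auto
  also have "\<dots> \<le> (\<integral>\<omega>. (V \<omega>)\<^sup>2 \<partial>M) / e\<^sup>2"
    using V(2) \<open>0 < e\<close> by (intro integral_Markov_inequality_measure[where A = "{}"]) auto
  also have "\<dots> \<le> (\<Sum>k=m..<n. (\<integral>\<omega>. (d k \<omega>)\<^sup>2 \<partial>M)) / e\<^sup>2"
    using V(1) by (intro divide_right_mono) auto
  finally show ?thesis by (simp add: S_def)
qed

text \<open>The maximal inequality bounds the chance of an excursion of size \<open>e\<close> after
  time \<open>m\<close> by a tail of the convergent series of second moments. As \<open>m\<close>
  grows this chance tends to 0; countably many \<open>e\<close> then give the Cauchy
  criterion.\<close>

lemma AE_summable:
  assumes summ: "summable (\<lambda>n. \<integral>\<omega>. (d n \<omega>)\<^sup>2 \<partial>M)"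
  shows "AE \<omega> in M. summable (\<lambda>n. d n \<omega>)"
proof -
  define q where "q n = (\<integral>\<omega>. (d n \<omega>)\<^sup>2 \<partial>M)" for n
  have q0: "0 \<le> q n" for n by (simp add: q_def)
  have [measurable]: "d n \<in> borel_measurable M" for n
    by (rule meas_M[OF d])
  define E where "E e m = {\<omega>\<in>space M. \<exists>k\<ge>m. e \<le> \<bar>\<Sum>i=m..<k. d i \<omega>\<bar>}" for e m
  have E[measurable]: "E e m \<in> sets M" for e m unfolding E_def by measurable
  \<comment> \<open>The inequality holds on each finite window \<open>{m..n}\<close> with the same
    bound; the windows increase to \<open>E e m\<close>.\<close>
  have Ebound: "measure M (E e m) \<le> (\<Sum>i. q (i + m)) / e\<^sup>2" if "0 < e" for e m
  proof -
    define G where "G n = {\<omega>\<in>space M. \<exists>k\<in>{m..n}. e \<le> \<bar>\<Sum>i=m..<k. d i \<omega>\<bar>}" for n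
    have "(\<lambda>n. measure M (G n)) \<longlonglongrightarrow> measure M (\<Union>n. G n)"
    proof (rule finite_Lim_measure_incseq)
      show "range G \<subseteq> sets M" unfolding G_def by auto
      show "incseq G" unfolding G_def incseq_def by fastforce
    qed
    moreover have "(\<Union>n. G n) = E e m" by (fastforce simp: G_def E_def)
    ultimately have lim: "(\<lambda>n. measure M (G n)) \<longlonglongrightarrow> measure M (E e m)" by simp
    have "measure M (G n) \<le> (\<Sum>i. q (i + m)) / e\<^sup>2" for n
    proof -
      have "measure M (G n) \<le> (\<Sum>k=m..<n. q k) / e\<^sup>2"
        unfolding G_def q_def by (rule maximal_inequality[OF that])
      also have "(\<Sum>k=m..<n. q k) = (\<Sum>i<n - m. q (i + m))"
      proof (cases "m \<le> n")
        case True
        then show ?thesis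
          using sum.shift_bounds_nat_ivl[of q 0 m "n - m"] by (simp add: atLeast0LessThan)
      qed simp
      also have "\<dots> \<le> (\<Sum>i. q (i + m))"
        using summ q0 by (intro sum_le_suminf summable_ignore_initial_segment) (auto simp: q_def)
      finally show ?thesis by (simp add: divide_right_mono)
    qed
    then show ?thesis by (intro LIMSEQ_le_const2[OF lim]) auto
  qed
  have null: "(\<Inter>m. E e m) \<in> null_sets M" if e: "0 < e" for e
  proof -
    have "measure M (\<Inter>m. E e m) \<le> (\<Sum>i. q (i + m)) / e\<^sup>2" for m
      by (rule order_trans[OF finite_measure_mono Ebound[OF e, of m]]) auto
    moreover have "(\<lambda>m. (\<Sum>i. q (i + m)) / e\<^sup>2) \<longlonglongrightarrow> 0 / e\<^sup>2"
      by (intro tendsto_divide tendsto_const suminf_exist_split2) (use summ e in \<open>auto simp: q_def\<close>)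
    ultimately have "measure M (\<Inter>m. E e m) \<le> 0"
      by (intro LIMSEQ_le_const[of "\<lambda>m. (\<Sum>i. q (i + m)) / e\<^sup>2"]) auto
    then have "measure M (\<Inter>m. E e m) = 0" by (simp add: measure_le_0_iff)
    then show ?thesis by (intro null_setsI) (auto simp: emeasure_eq_measure)
  qed
  have "AE \<omega> in M. \<forall>j. \<omega> \<notin> (\<Inter>m. E (inverse (real (Suc j))) m)"
    unfolding AE_all_countable using null by (intro allI AE_not_in) auto
  then show ?thesis
  proof (rule AE_mp, intro AE_I2 impI)
    fix \<omega> assume \<omega>: "\<omega> \<in> space M" and no: "\<forall>j. \<omega> \<notin> (\<Inter>m. E (inverse (real (Suc j))) m)"
    show "summable (\<lambda>n. d n \<omega>)"
      unfolding summable_Cauchy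
    proof (intro allI impI)
      fix e :: real assume "0 < e"
      \<comment> \<open>Half of \<open>e\<close>, because a block from \<open>a\<close> to
        \<open>b\<close> is the difference of two blocks that start at \<open>m\<close>.\<close>
      then obtain j where j: "inverse (real (Suc j)) < e / 2" using reals_Archimedean[of "e / 2"] by auto
      obtain m where "\<omega> \<notin> E (inverse (real (Suc j))) m" using no by blast
      then have small: "\<bar>\<Sum>i=m..<k. d i \<omega>\<bar> < e / 2" if "k \<ge> m" for k
        using \<omega> that j unfolding E_def by fastforce
      have "norm (\<Sum>i=a..<b. d i \<omega>) < e" if "a \<ge> m" for a b
      proof (cases "a \<le> b")
        case True
        have "(\<Sum>i=m..<b. d i \<omega>) = (\<Sum>i=m..<a. d i \<omega>) + (\<Sum>i=a..<b. d i \<omega>)"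
          using True that by (simp add: sum.atLeastLessThan_concat)
        then show ?thesis using small[OF that] small[OF order_trans[OF that True]] unfolding real_norm_def by linarith
      next
        case False
        then show ?thesis using \<open>0 < e\<close> by simp
      qed
      then show "\<exists>N. \<forall>m\<ge>N. \<forall>n. norm (\<Sum>i=m..<n. d i \<omega>) < e" by blast
    qed
  qed
qed

end

section \<open>Averages and the oscillation inside classes\<close>

text \<open>Multiplied by \<open>t\<close>, the difference becomes a double sum of
  \<open>a i * b j * (x i - x j)\<close>, where only pairs of positive weight contribute. The total
  mass \<open>t\<close> is left free so that it can be \<open>1 - \<delta>\<close> once a common
  part of two distributions has been removed.\<close>

lemma averages_diff_le:
  fixes a b x :: "'i \<Rightarrow> real"
  assumes "finite I" "\<And>i. i \<in> I \<Longrightarrow> 0 \<le> a i" "\<And>i. i \<in> I \<Longrightarrow> 0 \<le> b i"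
    and "sum a I = t" "sum b I = t" "0 < t"
    and c: "\<And>i j. i \<in> I \<Longrightarrow> j \<in> I \<Longrightarrow> 0 < a i \<Longrightarrow> 0 < b j \<Longrightarrow> \<bar>x i - x j\<bar> \<le> c"
  shows "\<bar>(\<Sum>i\<in>I. a i * x i) - (\<Sum>i\<in>I. b i * x i)\<bar> \<le> t * c"
proof -
  have "(\<Sum>i\<in>I. \<Sum>j\<in>I. a i * b j * (x i - x j)) =
        (\<Sum>i\<in>I. \<Sum>j\<in>I. a i * x i * b j) - (\<Sum>i\<in>I. \<Sum>j\<in>I. a i * (b j * x j))"
    unfolding sum_subtractf[symmetric] by (intro sum.cong refl) (simp add: algebra_simps)
  also have "\<dots> = (\<Sum>i\<in>I. a i * x i) * t - t * (\<Sum>i\<in>I. b i * x i)"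
    unfolding sum_product[symmetric] assms(4,5) ..
  also have "\<dots> = t * ((\<Sum>i\<in>I. a i * x i) - (\<Sum>i\<in>I. b i * x i))"
    by (simp add: algebra_simps)
  finally have "t * \<bar>(\<Sum>i\<in>I. a i * x i) - (\<Sum>i\<in>I. b i * x i)\<bar> =
      \<bar>\<Sum>i\<in>I. \<Sum>j\<in>I. a i * b j * (x i - x j)\<bar>" using \<open>0 < t\<close> by (simp add: abs_mult)
  also have "\<dots> \<le> (\<Sum>i\<in>I. \<Sum>j\<in>I. \<bar>a i * b j * (x i - x j)\<bar>)"
    by (intro order_trans[OF sum_abs] sum_mono sum_abs)
  also have "\<dots> \<le> (\<Sum>i\<in>I. \<Sum>j\<in>I. a i * b j * c)"
  proof (intro sum_mono)
    fix i j assume ij: "i \<in> I" "j \<in> I"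
    then have "0 \<le> a i * b j" using assms(2,3) by simp
    moreover have "a i * b j * \<bar>x i - x j\<bar> \<le> a i * b j * c"
    proof (cases "a i = 0 \<or> b j = 0")
      case False
      then have "0 < a i" "0 < b j" using assms(2,3)[of i] assms(3)[of j] ij by (auto simp: less_le)
      then show ?thesis using c[OF ij] by (intro mult_left_mono) auto
    qed auto
    ultimately show "\<bar>a i * b j * (x i - x j)\<bar> \<le> a i * b j * c"
      using abs_mult[of "a i * b j" "x i - x j"] by (simp only: abs_of_nonneg)
  qed
  also have "\<dots> = t * (t * c)"
    unfolding sum_distrib_right[symmetric] sum_product[symmetric] assms(4,5) by (rule mult.assoc)
  finally show ?thesis using \<open>0 < t\<close> by simp
qed

text \<open>A seminorm whose kernel consists of the vectors that are constant on every class. The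
  diagonal pairs keep the set nonempty, so that \<open>Max\<close> has its usual meaning.\<close>

definition osc :: "('n \<Rightarrow> nat) \<Rightarrow> real ^ 'n \<Rightarrow> real" where
  "osc cls x = Max ((\<lambda>(i, j). \<bar>x $ i - x $ j\<bar>) ` {(i, j). cls i = cls j})"

lemma osc_ge: "cls i = cls j \<Longrightarrow> \<bar>x $ i - x $ j\<bar> \<le> osc cls x"
  unfolding osc_def by (rule Max_ge) auto

lemma osc_le: "(\<And>i j. cls i = cls j \<Longrightarrow> \<bar>x $ i - x $ j\<bar> \<le> c) \<Longrightarrow> osc cls x \<le> c"
  unfolding osc_def by (subst Max_le_iff) auto

lemma osc_nonneg: "0 \<le> osc cls x"
  using osc_ge[of cls undefined undefined x] by simp

lemma osc_add: "osc cls (x + y) \<le> osc cls x + osc cls y"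
proof (rule osc_le)
  fix i j assume "cls i = cls j"
  then show "\<bar>(x + y) $ i - (x + y) $ j\<bar> \<le> osc cls x + osc cls y"
    using osc_ge[of cls i j x] osc_ge[of cls i j y] by simp
qed

lemma osc_scaleR_le: "osc cls (c *\<^sub>R x) \<le> \<bar>c\<bar> * osc cls x"
proof (rule osc_le)
  fix i j assume "cls i = cls j"
  then have "\<bar>c\<bar> * \<bar>x $ i - x $ j\<bar> \<le> \<bar>c\<bar> * osc cls x" by (intro mult_left_mono osc_ge) auto
  then show "\<bar>(c *\<^sub>R x) $ i - (c *\<^sub>R x) $ j\<bar> \<le> \<bar>c\<bar> * osc cls x"
    by (simp add: abs_mult[symmetric] algebra_simps)
qed

lemma osc_le_norm: "osc cls x \<le> 2 * norm x"
proof (rule osc_le)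
  fix i j show "\<bar>x $ i - x $ j\<bar> \<le> 2 * norm x"
    using component_le_norm_cart[of x i] component_le_norm_cart[of x j] by linarith
qed

section \<open>Irreducible stochastic matrices and contraction of the oscillation\<close>

lemma matpow_transpose: "matpow (transpose A) k = transpose (matpow A k)"
proof (induction k)
  case 0
  then show ?case by (simp add: matpow_0 transpose_mat)
next
  case (Suc k)
  have "matpow A (k + 1) = matpow A k ** A" unfolding matpow_add matpow_1 ..
  then show ?case by (simp add: matpow_Suc Suc matrix_transpose_mul)
qed


locale cyclic_chain =
  fixes P :: "real ^ 'n ^ 'n" and cls :: "'n \<Rightarrow> nat"
  assumes nonneg: "nonneg_mat P" and irred: "irreducible_mat P" and stoch: "P *v 1 = 1"
    and cyc: "cyclic_classes P cls"
begin

lemma matpow_stoch: "matpow P k *v 1 = 1"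
  by (induction k) (simp_all add: matpow_0 matpow_Suc matrix_vector_mul_assoc[symmetric] stoch)

lemma row_sum: "(\<Sum>j\<in>UNIV. matpow P k $ i $ j) = 1"
  using arg_cong[OF matpow_stoch[of k], of "\<lambda>x. x $ i"] by (simp add: matrix_vector_mult_def)

lemma matpow_nonneg: "0 \<le> matpow P k $ i $ j"
  using nonneg_matpow[OF nonneg] by (simp add: nonneg_mat_def)

lemma row_pos: "\<exists>j. 0 < matpow P k $ i $ j"
proof (rule ccontr)
  assume "\<nexists>j. 0 < matpow P k $ i $ j"
  then have "matpow P k $ i $ j = 0" for j using matpow_nonneg[of k i j] by (simp add: less_le)
  then show False using row_sum[of k i] by simp
qed

text \<open>Every step advances the class number by one modulo the period, so the class reached
  after \<open>k\<close> steps depends only on the starting class.\<close>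

lemma cls_matpow:
  assumes "0 < matpow P k $ i $ j" "0 < matpow P k $ i' $ j'" "cls i = cls i'"
  shows "cls j = cls j'"
  using cyclic_classes_matpow[OF nonneg irred cyc assms(1)]
        cyclic_classes_matpow[OF nonneg irred cyc assms(2)] assms(3) by simp

text \<open>At two nodes of one class, the entries of \<open>matpow P k *v x\<close> are averages of
  \<open>x\<close> over one and the same class.\<close>

lemma osc_matpow_le: "osc cls (matpow P k *v x) \<le> osc cls x"
proof (rule osc_le)
  fix i i' assume ii: "cls i = cls i'"
  have "\<bar>(\<Sum>j\<in>UNIV. matpow P k $ i $ j * x $ j) - (\<Sum>j\<in>UNIV. matpow P k $ i' $ j * x $ j)\<bar>
          \<le> 1 * osc cls x"
    by (rule averages_diff_le) (simp_all add: matpow_nonneg row_sum osc_ge[OF cls_matpow[OF _ _ ii]])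
  then show "\<bar>(matpow P k *v x) $ i - (matpow P k *v x) $ i'\<bar> \<le> osc cls x"
    by (simp add: matrix_vector_mult_def)
qed

lemma osc_mult_le: "osc cls (P *v x) \<le> osc cls x"
  using osc_matpow_le[of 1 x] by (simp only: matpow_1)

text \<open>The differences of return times to \<open>l\<close> form a subgroup of the integers; its generator divides
  every return time, hence the period.\<close>

lemma return_times_diff:
  assumes "int (period P) dvd a"
  shows "\<exists>s t. 0 < matpow P s $ l $ l \<and> 0 < matpow P t $ l $ l \<and> a = int s - int t"
proof -
  define R where "R = {k. 0 < matpow P k $ l $ l}"
  define D where "D = {int s - int t | s t. s \<in> R \<and> t \<in> R}"
  have R0: "0 \<in> R" by (simp add: R_def matpow_0 mat_def)
  have Radd: "s + t \<in> R" if "s \<in> R" "t \<in> R" for s t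
    using that matpow_pos_add[OF nonneg] by (auto simp: R_def)
  have Dadd: "x + y \<in> D" if xy: "x \<in> D" "y \<in> D" for x y
  proof -
    obtain s t s' t' where "x = int s - int t" "y = int s' - int t'" "s \<in> R" "t \<in> R" "s' \<in> R" "t' \<in> R"
      using xy unfolding D_def by blast
    then have "x + y = int (s + s') - int (t + t')" "s + s' \<in> R" "t + t' \<in> R" using Radd by auto
    then show ?thesis unfolding D_def by blast
  qed
  have Dneg: "- x \<in> D" if x: "x \<in> D" for x
  proof -
    obtain s t where "x = int s - int t" "s \<in> R" "t \<in> R" using x unfolding D_def by blast
    then have "- x = int t - int s" "s \<in> R" "t \<in> R" by auto
    then show ?thesis unfolding D_def by blast
  qed
  have RD: "int s \<in> D" if "s \<in> R" for s using that R0 unfolding D_def by force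
  have Dnat: "int n * x \<in> D" if x: "x \<in> D" for n x
  proof (induction n)
    case 0 then show ?case using RD[OF R0] by simp
  next
    case (Suc n)
    have "int (Suc n) * x = x + int n * x" by (simp add: algebra_simps)
    then show ?case using Dadd[OF x Suc] by simp
  qed
  have Dmult: "k * x \<in> D" if x: "x \<in> D" for k x
  proof (cases "0 \<le> k")
    case True
    then show ?thesis using Dnat[OF x, of "nat k"] by simp
  next
    case False
    then show ?thesis using Dneg[OF Dnat[OF x, of "nat (- k)"]] by simp
  qed
  define g where "g = (LEAST n. 0 < n \<and> int n \<in> D)"
  obtain k where k: "1 \<le> k" "0 < matpow P k $ l $ l" by (rule irreducible_matE[OF irred])
  then have "0 < k \<and> int k \<in> D" using RD by (simp add: R_def)
  then have g: "0 < g" "int g \<in> D"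
    using LeastI[of "\<lambda>n. 0 < n \<and> int n \<in> D" k] unfolding g_def by auto
  \<comment> \<open>Division with remainder: the remainder of a return time modulo \<open>g\<close>
    lies in \<open>D\<close> and is below \<open>g\<close>, so by minimality of \<open>g\<close> it
    cannot be positive.\<close>
  have "g dvd s" if "s \<in> R" for s
  proof (rule ccontr)
    assume "\<not> g dvd s"
    then have pos: "0 < s mod g" by (simp add: dvd_eq_mod_eq_0)
    have "int (s mod g) = int s + - (int (s div g) * int g)"
      using div_mult_mod_eq[of s g] by (metis add_diff_cancel_left' diff_conv_add_uminus of_nat_add of_nat_mult)
    then have "int (s mod g) \<in> D" using Dadd[OF RD[OF that] Dneg[OF Dmult[OF g(2)]]] by (rule ssubst)
    with pos have "g \<le> s mod g" unfolding g_def by (intro Least_le) simp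
    moreover have "s mod g < g" using g by simp
    ultimately show False by simp
  qed
  then have "g dvd period_at P l" unfolding period_at_def R_def by (intro Gcd_greatest) auto
  then have "int g dvd a" unfolding period_at_eq_period[OF nonneg irred] using assms dvd_trans int_dvd_int_iff by blast
  then obtain q where "a = q * int g" unfolding dvd_def by (auto simp: mult.commute)
  then have "a \<in> D" using Dmult[OF g(2)] by simp
  then show ?thesis unfolding D_def R_def by blast
qed

text \<open>From \<open>i\<close> there is a path to \<open>i'\<close> whose length is a multiple of
  the period, hence a difference \<open>s - t\<close> of two return times to \<open>i'\<close>.
  Followed by the loop of length \<open>t\<close> it reaches \<open>i'\<close> at time
  \<open>s\<close>, when the loop of length \<open>s\<close> also brings \<open>i'\<close> back to
  itself.\<close>

lemma same_class_meet:
  assumes "cls i = cls i'"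
  shows "\<exists>s j. 0 < matpow P s $ i $ j \<and> 0 < matpow P s $ i' $ j"
proof -
  obtain k where k: "0 < matpow P (period P * k) $ i $ i'"
    using cyclic_classes_iff[OF nonneg irred cyc, of i i'] assms by (auto simp: matpow_mult)
  obtain s t where st: "0 < matpow P s $ i' $ i'" "0 < matpow P t $ i' $ i'"
      "int (period P * k) = int s - int t"
    using return_times_diff[of "int (period P * k)" i'] by auto
  have "0 < matpow P (period P * k + t) $ i $ i'" by (rule matpow_pos_add[OF nonneg k st(2)])
  moreover have "period P * k + t = s" using st(3) by linarith
  ultimately show ?thesis using st(1) by auto
qed

text \<open>Doeblin's argument: after \<open>m\<close> steps the two distributions started from
  nodes of one class share mass at least \<open>\<delta>\<close> at a common node. This mass cancels
  in the difference of the averages, and mass \<open>1 - \<delta>\<close> remains on each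
  side.\<close>

lemma osc_matpow_contraction:
  "\<exists>m \<delta>. 1 \<le> m \<and> 0 < \<delta> \<and> \<delta> < 1 \<and> (\<forall>x. osc cls (matpow P m *v x) \<le> (1 - \<delta>) * osc cls x)"
proof -
  define s where "s = (\<lambda>(i, i'). SOME s. \<exists>j. 0 < matpow P s $ i $ j \<and> 0 < matpow P s $ i' $ j)"
  \<comment> \<open>One time for all pairs: two paths that have met can be continued together for as
    long as desired. The added 1 gives \<open>1 \<le> m\<close>.\<close>
  define m where "m = Max (range s) + 1"
  have meet: "\<exists>j. 0 < matpow P m $ i $ j \<and> 0 < matpow P m $ i' $ j" if "cls i = cls i'" for i i'
  proof -
    have "\<exists>j. 0 < matpow P (s (i, i')) $ i $ j \<and> 0 < matpow P (s (i, i')) $ i' $ j"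
      unfolding s_def using someI_ex[OF same_class_meet[OF that]] by simp
    then obtain j where j: "0 < matpow P (s (i, i')) $ i $ j" "0 < matpow P (s (i, i')) $ i' $ j" by blast
    have "s (i, i') \<le> Max (range s)" by (rule Max_ge) auto
    then have m: "m = s (i, i') + (m - s (i, i'))" unfolding m_def by linarith
    obtain j' where "0 < matpow P (m - s (i, i')) $ j $ j'" using row_pos by blast
    then have "0 < matpow P (s (i, i') + (m - s (i, i'))) $ i $ j'"
              "0 < matpow P (s (i, i') + (m - s (i, i'))) $ i' $ j'"
      using matpow_pos_add[OF nonneg j(1)] matpow_pos_add[OF nonneg j(2)] by blast+
    then show ?thesis unfolding m[symmetric] by blast
  qed
  \<comment> \<open>The value 1/2 keeps \<open>\<delta>\<close> below 1 even when the positive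
    entries of the power all equal 1.\<close>
  define \<delta> where "\<delta> = Min (insert (1/2) {matpow P m $ i $ j | i j. 0 < matpow P m $ i $ j})"
  have fin: "finite {matpow P m $ i $ j | i j. 0 < matpow P m $ i $ j}"
    by (rule finite_subset[of _ "(\<lambda>(i, j). matpow P m $ i $ j) ` UNIV"]) auto
  have \<delta>: "0 < \<delta>" "\<delta> < 1"
    unfolding \<delta>_def using fin by (auto simp: Min_gr_iff Min_less_iff)
  have \<delta>le: "\<delta> \<le> matpow P m $ i $ j" if "0 < matpow P m $ i $ j" for i j
    unfolding \<delta>_def using fin that by (intro Min_le) auto
  have "osc cls (matpow P m *v x) \<le> (1 - \<delta>) * osc cls x" for x
  proof (rule osc_le)
    fix i i' assume ii: "cls i = cls i'"
    obtain j0 where j0: "0 < matpow P m $ i $ j0" "0 < matpow P m $ i' $ j0" using meet[OF ii] by blast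
    define p where "p i j = matpow P m $ i $ j - (if j = j0 then \<delta> else 0)" for i j
    have le: "p i j \<le> matpow P m $ i $ j" for i j using \<delta> by (simp add: p_def)
    have "\<bar>(\<Sum>j\<in>UNIV. p i j * x $ j) - (\<Sum>j\<in>UNIV. p i' j * x $ j)\<bar> \<le> (1 - \<delta>) * osc cls x"
    proof (rule averages_diff_le)
      fix j j' assume "0 < p i j" "0 < p i' j'"
      then have "0 < matpow P m $ i $ j" "0 < matpow P m $ i' $ j'" using le by (meson less_le_trans)+
      then show "\<bar>x $ j - x $ j'\<bar> \<le> osc cls x" by (intro osc_ge cls_matpow[OF _ _ ii])
    qed (use \<delta> \<delta>le j0 in \<open>auto simp: p_def matpow_nonneg sum_subtractf row_sum sum.delta\<close>)
    also have "(\<Sum>j\<in>UNIV. p i j * x $ j) - (\<Sum>j\<in>UNIV. p i' j * x $ j) =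
               (matpow P m *v x) $ i - (matpow P m *v x) $ i'"
      by (simp add: p_def matrix_vector_mult_def left_diff_distrib sum_subtractf)
    finally show "\<bar>(matpow P m *v x) $ i - (matpow P m *v x) $ i'\<bar> \<le> (1 - \<delta>) * osc cls x" .
  qed
  moreover have "1 \<le> m" by (simp add: m_def)
  ultimately show ?thesis using \<delta> by blast
qed

text \<open>Weighting the oscillations along \<open>m\<close> steps turns the \<open>m\<close>-step contraction into a one-step one.\<close>

lemma contracting_seminorm:
  obtains \<theta> K :: real and N :: "real ^ 'n \<Rightarrow> real"
  where "0 < \<theta>" "\<theta> < 1" "0 < K" "\<And>x. osc cls x \<le> N x" "\<And>x. N x \<le> K * norm x"
    "\<And>x y. N (x + y) \<le> N x + N y" "\<And>c x. N (c *\<^sub>R x) \<le> \<bar>c\<bar> * N x" "\<And>x. N (P *v x) \<le> \<theta> * N x"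
proof -
  obtain m \<delta> where m: "1 \<le> m" "0 < \<delta>" "\<delta> < 1"
      "\<And>x. osc cls (matpow P m *v x) \<le> (1 - \<delta>) * osc cls x"
    using osc_matpow_contraction by blast
  \<comment> \<open>The contraction over \<open>m\<close> steps is spread evenly, a factor
    \<open>\<theta>\<close> per step; accordingly the oscillation after \<open>i\<close> steps gets
    the weight \<open>\<theta>\<close> to the power \<open>-i\<close>.\<close>
  define \<theta> where "\<theta> = root m (1 - \<delta>)"
  have \<theta>: "0 < \<theta>" "\<theta> < 1" "\<theta> ^ m = 1 - \<delta>"
    using m by (auto simp: \<theta>_def real_root_pow_pos2)
  define o' where "o' i x = osc cls (matpow P i *v x)" for i x
  define w where "w i = inverse (\<theta> ^ i)" for i
  define N where "N x = (\<Sum>i<m. w i * o' i x)" for x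
  have w: "0 < w i" for i using \<theta> by (simp add: w_def)
  have o0: "0 \<le> o' i x" for i x by (simp add: o'_def osc_nonneg)
  have a: "osc cls x \<le> N x" for x
  proof -
    have "w 0 * o' 0 x \<le> N x" unfolding N_def
      by (rule member_le_sum) (use m w o0 in \<open>auto simp: less_imp_le\<close>)
    then show ?thesis by (simp add: w_def o'_def matpow_0)
  qed
  have b: "N x \<le> (\<Sum>i<m. w i * 2) * norm x" for x
  proof -
    have "N x \<le> (\<Sum>i<m. w i * (2 * norm x))" unfolding N_def o'_def
      by (intro sum_mono mult_left_mono order_trans[OF osc_matpow_le osc_le_norm]) (simp add: w less_imp_le)
    then show ?thesis by (simp add: sum_distrib_right mult.assoc)
  qed
  have K: "0 < (\<Sum>i<m. w i * 2)" using m w by (intro sum_pos) (auto simp: lessThan_empty_iff)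
  have c: "N (x + y) \<le> N x + N y" for x y
    unfolding N_def o'_def sum.distrib[symmetric] distrib_left[symmetric] matrix_vector_right_distrib
    by (intro sum_mono mult_left_mono osc_add) (simp add: w less_imp_le)
  have d: "N (c *\<^sub>R x) \<le> \<bar>c\<bar> * N x" for c x
  proof -
    have "N (c *\<^sub>R x) \<le> (\<Sum>i<m. w i * (\<bar>c\<bar> * o' i x))" unfolding N_def o'_def matrix_vector_mult_scaleR
      by (intro sum_mono mult_left_mono osc_scaleR_le) (simp add: w less_imp_le)
    then show ?thesis by (simp add: N_def sum_distrib_left algebra_simps)
  qed
  have e: "N (P *v x) \<le> \<theta> * N x" for x
  proof -
    have sh: "o' i (P *v x) = o' (Suc i) x" for i
      unfolding o'_def matrix_vector_mul_assoc using matpow_add[of P i 1] by (simp only: matpow_1 Suc_eq_plus1)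
    have ws: "w i = \<theta> * w (Suc i)" for i using \<theta> by (simp add: w_def)
    have "N (P *v x) = \<theta> * (\<Sum>i<m. w (Suc i) * o' (Suc i) x)"
      unfolding N_def sh sum_distrib_left by (intro sum.cong refl) (subst ws, rule mult.assoc)
    \<comment> \<open>The shift trades the term at 0 for the term at \<open>m\<close>, which the
      \<open>m\<close>-step contraction and \<open>\<theta> ^ m = 1 - \<delta>\<close> make no
      larger.\<close>
    also have "(\<Sum>i<m. w (Suc i) * o' (Suc i) x) = N x - w 0 * o' 0 x + w m * o' m x"
      unfolding N_def using sum.lessThan_Suc_shift[of "\<lambda>i. w i * o' i x" m] by simp
    also have "\<dots> \<le> N x"
    proof -
      have "w m * o' m x \<le> w m * ((1 - \<delta>) * o' 0 x)"
        using m(4)[of x] w[of m] by (intro mult_left_mono) (auto simp: o'_def matpow_0)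
      also have "\<dots> = w 0 * o' 0 x" using \<theta> m(3) by (simp add: w_def)
      finally show ?thesis by simp
    qed
    finally show ?thesis using \<theta> by (simp add: mult_left_mono)
  qed
  show thesis by (rule that[OF \<theta>(1,2) K a b c d e])
qed

section \<open>Oscillation along the relaxed recursion, with and without noise\<close>

text \<open>The noise \<open>e n\<close> need not be small relative to \<open>r n\<close>. Adding
  its tail \<open>T n\<close> to \<open>z n\<close> absorbs it: the sum \<open>U n\<close> obeys the
  same recursion with the perturbation \<open>r n *\<^sub>R (T n - P *v T n)\<close>, which carries
  the factor \<open>r n\<close> that \<open>contraction_recursion_tendsto_0\<close> asks
  for.\<close>

lemma relaxation_oscillation_tendsto_0:
  fixes z e :: "nat \<Rightarrow> real ^ 'n" and r :: "nat \<Rightarrow> real"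
  assumes r: "\<And>n. 0 < r n \<and> r n < 1"
    and div: "filterlim (\<lambda>n. \<Sum>k<n. r k) at_top sequentially"
    and rec: "\<And>n. z (Suc n) = (1 - r n) *\<^sub>R z n + r n *\<^sub>R (P *v z n) + e n"
    and e: "summable e"
  shows "(\<lambda>n. osc cls (z n)) \<longlonglongrightarrow> 0"
proof -
  obtain \<theta> K :: real and N :: "real ^ 'n \<Rightarrow> real"
    where N: "0 < \<theta>" "\<theta> < 1" "0 < K" "\<And>x. osc cls x \<le> N x" "\<And>x. N x \<le> K * norm x"
      "\<And>x y. N (x + y) \<le> N x + N y" "\<And>c x. N (c *\<^sub>R x) \<le> \<bar>c\<bar> * N x" "\<And>x. N (P *v x) \<le> \<theta> * N x"
    by (rule contracting_seminorm) (rule that)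
  have N0: "0 \<le> N x" for x using N(4)[of x] osc_nonneg[of cls x] by linarith
  define T where "T n = (\<Sum>k. e (k + n))" for n
  have T: "T \<longlonglongrightarrow> 0" unfolding T_def by (rule suminf_exist_split2[OF e])
  have TS: "T n = e n + T (Suc n)" for n
    using suminf_split_head[OF summable_ignore_initial_segment[OF e, of n]] by (simp add: T_def)
  have NT: "(\<lambda>n. N (T n)) \<longlonglongrightarrow> 0"
  proof (rule tendsto_sandwich[OF _ _ tendsto_const])
    show "(\<lambda>n. K * norm (T n)) \<longlonglongrightarrow> 0"
      using tendsto_mult[OF tendsto_const[of K] tendsto_norm[OF T]] by simp
  qed (use N0 N(5) in auto)
  define U where "U n = z n + T n" for n
  have U: "(\<lambda>n. N (U n)) \<longlonglongrightarrow> 0"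
  proof (rule contraction_recursion_tendsto_0[OF _ _ r div])
    show "0 < 1 - \<theta>" "1 - \<theta> \<le> 1" using N by auto
    show "(\<lambda>n. 2 * N (T n)) \<longlonglongrightarrow> 0" using tendsto_mult[OF tendsto_const[of 2] NT] by simp
    fix n
    show "0 \<le> N (U n)" by (rule N0)
    have "U (Suc n) = ((1 - r n) *\<^sub>R U n + r n *\<^sub>R (P *v U n)) + (r n *\<^sub>R T n + (- r n) *\<^sub>R (P *v T n))"
      using rec[of n] TS[of n]
      by (simp add: U_def matrix_vector_right_distrib algebra_simps)
    also have "N \<dots> \<le> (N ((1 - r n) *\<^sub>R U n) + N (r n *\<^sub>R (P *v U n))) +
                       (N (r n *\<^sub>R T n) + N ((- r n) *\<^sub>R (P *v T n)))"
      by (intro order_trans[OF N(6)] add_mono N(6))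
    also have "\<dots> \<le> (\<bar>1 - r n\<bar> * N (U n) + \<bar>r n\<bar> * (\<theta> * N (U n))) +
                       (\<bar>r n\<bar> * N (T n) + \<bar>- r n\<bar> * N (T n))"
    proof -
      have "N (P *v T n) \<le> 1 * N (T n)"
        by (rule order_trans[OF N(8) mult_right_mono]) (use N(2) N0 in \<open>auto intro: less_imp_le\<close>)
      then show ?thesis
        by (intro add_mono N(7) order_trans[OF N(7)] mult_left_mono N(8)) auto
    qed
    also have "\<dots> = (1 - (1 - \<theta>) * r n) * N (U n) + r n * (2 * N (T n))"
      using r[of n] by (simp add: algebra_simps)
    finally show "N (U (Suc n)) \<le> (1 - (1 - \<theta>) * r n) * N (U n) + r n * (2 * N (T n))" .
  qed
  show ?thesis
  proof (rule tendsto_sandwich[OF _ _ tendsto_const])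
    show "(\<lambda>n. N (U n) + N (T n)) \<longlonglongrightarrow> 0" using tendsto_add[OF U NT] by simp
    have "osc cls (z n) \<le> N (U n) + N (T n)" for n
    proof -
      have "osc cls (z n) \<le> N (U n + (- 1) *\<^sub>R T n)" using N(4)[of "z n"] by (simp add: U_def)
      also have "\<dots> \<le> N (U n) + \<bar>- 1\<bar> * N (T n)" by (rule order_trans[OF N(6)]) (intro add_left_mono N(7))
      finally show ?thesis by simp
    qed
    then show "\<forall>\<^sub>F n in sequentially. osc cls (z n) \<le> N (U n) + N (T n)" by simp
  qed (simp add: osc_nonneg)
qed

text \<open>One step can lower the oscillation at most by the factor \<open>1 - 2 * r n\<close>, and
  for summable steps the product of these factors stays away from 0. A positive oscillation at
  \<open>n0\<close> would therefore survive in the limit.\<close>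

lemma relaxation_oscillation_eq_0:
  fixes y :: "nat \<Rightarrow> real ^ 'n" and r :: "nat \<Rightarrow> real"
  assumes r: "\<And>n. 0 < r n \<and> r n < 1" and summ: "summable r"
    and rec: "\<And>n. n0 \<le> n \<Longrightarrow> y (Suc n) = (1 - r n) *\<^sub>R y n + r n *\<^sub>R (P *v y n)"
    and small: "\<And>n. n0 \<le> n \<Longrightarrow> r n \<le> 1 / 4"
    and lim: "(\<lambda>n. osc cls (y n)) \<longlonglongrightarrow> 0"
  shows "osc cls (y n0) = 0"
proof -
  have osc_Suc: "(1 - 2 * r n) * osc cls (y n) \<le> osc cls (y (Suc n))" if "n0 \<le> n" for n
  proof -
    have "(1 - r n) *\<^sub>R y n = y (Suc n) + (- r n) *\<^sub>R (P *v y n)" using rec[OF that] by simp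
    then have "y n = y (Suc n) + (- r n) *\<^sub>R (P *v y n) + r n *\<^sub>R y n" by (simp add: algebra_simps)
    then have "osc cls (y n) = osc cls (y (Suc n) + (- r n) *\<^sub>R (P *v y n) + r n *\<^sub>R y n)"
      by (rule arg_cong)
    also have "\<dots> \<le> osc cls (y (Suc n)) + osc cls ((- r n) *\<^sub>R (P *v y n)) + osc cls (r n *\<^sub>R y n)"
      by (rule order_trans[OF osc_add add_right_mono[OF osc_add]])
    also have "\<dots> \<le> osc cls (y (Suc n)) + r n * osc cls (y n) + r n * osc cls (y n)"
    proof (intro add_mono order_refl)
      have "osc cls ((- r n) *\<^sub>R (P *v y n)) \<le> \<bar>- r n\<bar> * osc cls (y n)"
        by (rule order_trans[OF osc_scaleR_le mult_left_mono[OF osc_mult_le]]) simp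
      then show "osc cls ((- r n) *\<^sub>R (P *v y n)) \<le> r n * osc cls (y n)" using r[of n] by simp
      show "osc cls (r n *\<^sub>R y n) \<le> r n * osc cls (y n)"
        using osc_scaleR_le[of cls "r n" "y n"] r[of n] by simp
    qed
    finally show ?thesis by (simp add: algebra_simps)
  qed
  \<comment> \<open>Up to 1/4 one has
    \<open>(1 - 2 * x) * (1 + 4 * x) = 1 + 2 * x * (1 - 4 * x) \<ge> 1\<close>; this is the source
    of the bound 1/4 on the steps.\<close>
  have ex: "exp (- 4 * x) \<le> 1 - 2 * x" if "0 \<le> x" "x \<le> 1 / 4" for x :: real
  proof -
    have "1 + 4 * x \<le> exp (4 * x)" by (rule exp_ge_add_one_self)
    moreover have "1 \<le> (1 - 2 * x) * (1 + 4 * x)" 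
      using mult_nonneg_nonneg[of x "1 - 4 * x"] that by (simp add: algebra_simps)
    ultimately have "1 \<le> (1 - 2 * x) * exp (4 * x)"
      using mult_left_mono[of "1 + 4 * x" "exp (4 * x)" "1 - 2 * x"] that by linarith
    then show ?thesis by (simp add: exp_minus field_simps)
  qed
  have low: "exp (- 4 * (\<Sum>k=n0..<n. r k)) * osc cls (y n0) \<le> osc cls (y n)" if "n0 \<le> n" for n
    using that
  proof (induction n rule: dec_induct)
    case (step n)
    have "exp (- 4 * (\<Sum>k=n0..<Suc n. r k)) * osc cls (y n0) =
          exp (- 4 * r n) * (exp (- 4 * (\<Sum>k=n0..<n. r k)) * osc cls (y n0))"
      using step(1) by (simp add: exp_add[symmetric] algebra_simps)
    also have "\<dots> \<le> (1 - 2 * r n) * osc cls (y n)"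
      using ex[of "r n"] r[of n] small[OF step(1)] step.IH osc_nonneg[of cls "y n0"]
      by (intro mult_mono) auto
    finally show ?case using osc_Suc[OF step(1)] by linarith
  qed simp
  have "exp (- 4 * suminf r) * osc cls (y n0) \<le> osc cls (y n)" if "n0 \<le> n" for n
  proof -
    have "(\<Sum>k=n0..<n. r k) \<le> suminf r"
      using r summ by (intro sum_le_suminf) (auto simp: less_imp_le)
    then have "exp (- 4 * suminf r) \<le> exp (- 4 * (\<Sum>k=n0..<n. r k))" by simp
    then show ?thesis using low[OF that] osc_nonneg[of cls "y n0"] by (meson mult_right_mono order_trans)
  qed
  then have "exp (- 4 * suminf r) * osc cls (y n0) \<le> 0" by (intro LIMSEQ_le_const[OF lim]) auto
  then show ?thesis using osc_nonneg[of cls "y n0"] by (simp add: mult_le_0_iff)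
qed

end

section \<open>The third component and the oscillation\<close>

lemma Zpart3_eq: "Zpart3 cls v z = z - Zclass cls v z"
  by (simp add: Zpart3_def Zpart1_def Zpart2_def)

lemma Zclass_cong: "cls i = cls j \<Longrightarrow> Zclass cls v z $ i = Zclass cls v z $ j"
  by (simp add: Zclass_def)

text \<open>The subtracted vector of class averages is constant on classes, hence invisible to
  \<open>osc\<close>.\<close>

lemma osc_Zpart3: "osc cls (Zpart3 cls v z) = osc cls z"
proof -
  have "(\<lambda>(i, j). \<bar>Zpart3 cls v z $ i - Zpart3 cls v z $ j\<bar>) ` {(i, j). cls i = cls j} =
        (\<lambda>(i, j). \<bar>z $ i - z $ j\<bar>) ` {(i, j). cls i = cls j}"
  proof (intro image_cong refl, clarify)
    fix i j assume "cls i = cls j"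
    then show "\<bar>Zpart3 cls v z $ i - Zpart3 cls v z $ j\<bar> = \<bar>z $ i - z $ j\<bar>"
      using Zclass_cong[of cls i j v z] by (simp add: Zpart3_eq)
  qed
  then show ?thesis by (simp only: osc_def)
qed

text \<open>The entry at \<open>l\<close> compares two averages over the class of \<open>l\<close>:
  the point mass at \<open>l\<close> and the normalised weights \<open>v\<close>.\<close>

lemma norm_Zpart3_le:
  fixes v z :: "real ^ 'n"
  assumes v: "\<And>l. 0 < v $ l"
  shows "norm (Zpart3 cls v z) \<le> real CARD('n) * osc cls z"
proof -
  have "\<bar>Zpart3 cls v z $ l\<bar> \<le> osc cls z" for l
  proof -
    define I where "I = {i. cls i = cls l}"
    have V: "0 < (\<Sum>i\<in>I. v $ i)" using v by (intro sum_pos) (auto simp: I_def)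
    have "\<bar>(\<Sum>i\<in>I. (if i = l then 1 else 0) * z $ i) - (\<Sum>i\<in>I. v $ i / (\<Sum>i\<in>I. v $ i) * z $ i)\<bar>
            \<le> 1 * osc cls z"
    proof (rule averages_diff_le)
      show "(\<Sum>i\<in>I. v $ i / (\<Sum>i\<in>I. v $ i)) = 1"
        using V unfolding sum_divide_distrib[symmetric] by simp
      show "0 \<le> v $ i / (\<Sum>i\<in>I. v $ i)" for i
        using V v[of i] by simp
      show "\<bar>z $ i - z $ j\<bar> \<le> osc cls z" if "i \<in> I" "j \<in> I" for i j
        using that by (intro osc_ge) (simp add: I_def)
    qed (simp_all add: I_def)
    moreover have "(\<Sum>i\<in>I. (if i = l then 1 else 0) * z $ i) = (\<Sum>i\<in>I. if i = l then z $ i else 0)"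
      by (intro sum.cong) auto
    then have "(\<Sum>i\<in>I. (if i = l then 1 else 0) * z $ i) = z $ l"
      by (simp add: I_def)
    ultimately show ?thesis by (simp add: Zpart3_eq Zclass_def I_def)
  qed
  then have "(\<Sum>l\<in>UNIV. \<bar>Zpart3 cls v z $ l\<bar>) \<le> real CARD('n) * osc cls z"
    by (intro sum_bounded_above) auto
  then show ?thesis using norm_le_l1_cart[of "Zpart3 cls v z"] by linarith
qed

lemma Zpart3_tendsto_0_iff:
  fixes v :: "real ^ 'n"
  assumes v: "\<And>l. 0 < v $ l"
  shows "(\<lambda>n. Zpart3 cls v (z n)) \<longlonglongrightarrow> 0 \<longleftrightarrow> (\<lambda>n. osc cls (z n)) \<longlonglongrightarrow> 0"
proof
  assume "(\<lambda>n. Zpart3 cls v (z n)) \<longlonglongrightarrow> 0"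
  then have "(\<lambda>n. 2 * norm (Zpart3 cls v (z n))) \<longlonglongrightarrow> 0"
    by (intro tendsto_mult_right_zero tendsto_norm_zero)
  then show "(\<lambda>n. osc cls (z n)) \<longlonglongrightarrow> 0"
  proof (rule tendsto_sandwich[OF _ _ tendsto_const, rotated 2])
    show "\<forall>\<^sub>F n in sequentially. osc cls (z n) \<le> 2 * norm (Zpart3 cls v (z n))"
      using osc_le_norm[of cls "Zpart3 cls v (z n)" for n] by (simp add: osc_Zpart3)
  qed (simp add: osc_nonneg)
next
  assume "(\<lambda>n. osc cls (z n)) \<longlonglongrightarrow> 0"
  then have "(\<lambda>n. real CARD('n) * osc cls (z n)) \<longlonglongrightarrow> 0"
    by (rule tendsto_mult_right_zero)
  then show "(\<lambda>n. Zpart3 cls v (z n)) \<longlonglongrightarrow> 0"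
    by (rule Lim_null_comparison[rotated]) (simp add: norm_Zpart3_le[OF v])
qed

section \<open>Convergence of vector series and divergence of nonnegative series\<close>

lemma summable_vec:
  fixes f :: "nat \<Rightarrow> real ^ 'n"
  assumes "\<And>l. summable (\<lambda>n. f n $ l)"
  shows "summable f"
proof -
  have "f sums (\<chi> l. \<Sum>n. f n $ l)"
    unfolding sums_def
    by (rule vec_tendstoI) (use assms in \<open>simp add: summable_LIMSEQ\<close>)
  then show ?thesis by (rule sums_summable)
qed

lemma sum_at_top_iff_not_summable:
  fixes r :: "nat \<Rightarrow> real"
  assumes r: "\<And>n. 0 \<le> r n"
  shows "filterlim (\<lambda>n. \<Sum>k<n. r k) at_top sequentially \<longleftrightarrow> \<not> summable r"
proof
  assume lim: "filterlim (\<lambda>n. \<Sum>k<n. r k) at_top sequentially"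
  show "\<not> summable r"
  proof
    assume "summable r"
    then show False
      by (rule not_tendsto_and_filterlim_at_infinity[OF sequentially_bot summable_LIMSEQ
            filterlim_at_top_imp_at_infinity[OF lim]])
  qed
next
  assume ns: "\<not> summable r"
  show "filterlim (\<lambda>n. \<Sum>k<n. r k) at_top sequentially"
    unfolding filterlim_at_top
  proof
    fix B :: real
    have "\<exists>n. B \<le> (\<Sum>k<n. r k)"
    proof (rule ccontr)
      assume "\<nexists>n. B \<le> (\<Sum>k<n. r k)"
      then have "summable r"
        by (intro summableI_nonneg_bounded[of r B]) (auto simp: r not_le intro: less_imp_le)
      with ns show False by contradiction
    qed
    then obtain n where n: "B \<le> (\<Sum>k<n. r k)" by blast
    have "B \<le> (\<Sum>k<m. r k)" if "n \<le> m" for m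
      by (rule order_trans[OF n sum_mono2]) (use that r in auto)
    then show "\<forall>\<^sub>F n in sequentially. B \<le> (\<Sum>k<n. r k)" by (auto simp: eventually_sequentially)
  qed
qed

section \<open>The reinforced process: filtration, moments of the draws, summable noise\<close>

locale reinforced_network = prob_space M + cyclic_chain P cls
  for M :: "'a measure" and P :: "real ^ 'n ^ 'n" and cls :: "'n \<Rightarrow> nat" +
  fixes r :: "nat \<Rightarrow> real" and Z X :: "nat \<Rightarrow> 'a \<Rightarrow> real ^ 'n" and v :: "real ^ 'n"
  assumes r: "0 < r n \<and> r n < 1"
    and Z0: "Z 0 \<in> borel_measurable M"
    and Z0_01: "\<omega> \<in> space M \<Longrightarrow> Z 0 \<omega> $ l \<in> {0..1}"
    and X: "X (Suc n) \<in> borel_measurable M"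
    and X01: "\<omega> \<in> space M \<Longrightarrow> X (Suc n) \<omega> $ l \<in> {0, 1}"
    and indep: "cond_indep_vars M (hist_algebra M Z X n) (\<lambda>_. borel) (\<lambda>l \<omega>. X (Suc n) \<omega> $ l) UNIV"
    and cond: "AE \<omega> in M. cprob M (hist_algebra M Z X n) {\<omega>\<in>space M. X (Suc n) \<omega> $ l = 1} \<omega> =
                           (P *v Z n \<omega>) $ l"
    and rec: "\<omega> \<in> space M \<Longrightarrow> Z (Suc n) \<omega> = (1 - r n) *\<^sub>R Z n \<omega> + r n *\<^sub>R X (Suc n) \<omega>"
    and v_pos: "0 < v $ l" and v_stat: "v v* P = v" and v_sum: "v \<bullet> 1 = 1"
begin

abbreviation F :: "nat \<Rightarrow> 'a measure" where "F \<equiv> hist_algebra M Z X"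

text \<open>By \<open>cond\<close>, a version of the conditional probability that node
  \<open>l\<close> draws 1 next, given the past.\<close>

definition p :: "nat \<Rightarrow> 'n \<Rightarrow> 'a \<Rightarrow> real" where "p n l \<omega> = (\<Sum>j\<in>UNIV. P $ l $ j * Z n \<omega> $ j)"

text \<open>The centred draw, a martingale difference with respect to \<open>F\<close>.\<close>

definition D :: "nat \<Rightarrow> 'n \<Rightarrow> 'a \<Rightarrow> real" where "D n l \<omega> = X (Suc n) \<omega> $ l - p n l \<omega>"

lemma p_eq: "(P *v Z n \<omega>) $ l = p n l \<omega>"
  by (simp add: p_def matrix_vector_mult_def)

lemma subalg: "subalgebra M (F n)"
proof (rule subalgebra_hist_algebra)
  show "Z 0 \<in> borel_measurable M" by (rule Z0)
  fix k :: nat assume "1 \<le> k"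
  then show "X k \<in> borel_measurable M" using X[of "k - 1"] by simp
qed

lemma space_F: "space (F n) = space M"
  using subalg by (simp add: subalgebra_def)

lemma sets_F: "sets (F n) = sigma_sets (space M)
     ({(\<lambda>\<omega>. Z 0 \<omega> $ l) -` B \<inter> space M | l B. B \<in> sets borel} \<union>
      {(\<lambda>\<omega>. X k \<omega> $ l) -` B \<inter> space M | k l B. 1 \<le> k \<and> k \<le> n \<and> B \<in> sets borel})"
  unfolding hist_algebra_def by (rule sets_measure_of) auto

lemma F_mono: "m \<le> n \<Longrightarrow> sets (F m) \<subseteq> sets (F n)"
  unfolding sets_F
  by (intro sigma_sets_mono' Un_mono order_refl Collect_mono impI) (blast intro: order_trans)

lemma F_meas_mono: "f \<in> borel_measurable (F m) \<Longrightarrow> m \<le> n \<Longrightarrow> f \<in> borel_measurable (F n)"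
  for f :: "'a \<Rightarrow> real"
  by (rule measurable_from_subalg[of _ "F m"]) (simp_all add: subalgebra_def space_F F_mono)

lemma F_meas_M: "f \<in> borel_measurable (F n) \<Longrightarrow> f \<in> borel_measurable M" for f :: "'a \<Rightarrow> real"
  by (rule measurable_from_subalg[OF subalg])

lemma Z0_F: "(\<lambda>\<omega>. Z 0 \<omega> $ l) \<in> borel_measurable (F n)"
  by (rule measurableI) (auto simp: sets_F space_F intro!: sigma_sets.Basic)

lemma X_F: "1 \<le> k \<Longrightarrow> k \<le> n \<Longrightarrow> (\<lambda>\<omega>. X k \<omega> $ l) \<in> borel_measurable (F n)"
  by (rule measurableI) (auto simp: sets_F space_F intro!: sigma_sets.Basic)

lemma rec_nth: "\<omega> \<in> space M \<Longrightarrow> Z (Suc n) \<omega> $ l = (1 - r n) * Z n \<omega> $ l + r n * X (Suc n) \<omega> $ l"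
  using rec by simp

lemma Z_F: "(\<lambda>\<omega>. Z n \<omega> $ l) \<in> borel_measurable (F n)"
proof (induction n)
  case 0
  show ?case by (rule Z0_F)
next
  case (Suc n)
  have [measurable]: "(\<lambda>\<omega>. Z n \<omega> $ l) \<in> borel_measurable (F (Suc n))"
    "(\<lambda>\<omega>. X (Suc n) \<omega> $ l) \<in> borel_measurable (F (Suc n))"
    using F_meas_mono[OF Suc] X_F by auto
  have "(\<lambda>\<omega>. (1 - r n) * Z n \<omega> $ l + r n * X (Suc n) \<omega> $ l) \<in> borel_measurable (F (Suc n))"
    by measurable
  then show ?case by (subst measurable_cong[OF rec_nth]) (simp_all add: space_F)
qed

lemma p_F: "p n l \<in> borel_measurable (F n)"
  unfolding p_def by (intro borel_measurable_sum borel_measurable_times Z_F) simp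

lemma D_F: "D n l \<in> borel_measurable (F (Suc n))"
  unfolding D_def
  by (intro borel_measurable_diff X_F F_meas_mono[OF p_F]) auto

lemma meas_M [measurable]:
  "(\<lambda>\<omega>. Z n \<omega> $ l) \<in> borel_measurable M"
  "p n l \<in> borel_measurable M"
  "(\<lambda>\<omega>. X (Suc n) \<omega> $ l) \<in> borel_measurable M"
  "D n l \<in> borel_measurable M"
  by (rule F_meas_M[OF Z_F] F_meas_M[OF p_F] F_meas_M[OF X_F[of "Suc n" "Suc n"]] F_meas_M[OF D_F]; simp)+

lemma Z_01: "\<omega> \<in> space M \<Longrightarrow> 0 \<le> Z n \<omega> $ l \<and> Z n \<omega> $ l \<le> 1"
proof (induction n)
  case 0
  then show ?case using Z0_01 by simp
next
  case (Suc n)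
  have "(1 - r n) * Z n \<omega> $ l + r n * X (Suc n) \<omega> $ l \<le> (1 - r n) * 1 + r n * 1"
    using Suc X01[of \<omega> n l] r[of n] by (intro add_mono mult_left_mono) auto
  then show ?case using Suc X01[of \<omega> n l] r[of n] rec_nth[of \<omega> n l] by auto
qed

lemma X_0_1: "\<omega> \<in> space M \<Longrightarrow> 0 \<le> X (Suc n) \<omega> $ l \<and> X (Suc n) \<omega> $ l \<le> 1"
  using X01[of \<omega> n l] by auto

lemma P_nonneg: "0 \<le> P $ i $ j"
  using nonneg by (simp add: nonneg_mat_def)

lemma P_row_sum: "(\<Sum>j\<in>UNIV. P $ i $ j) = 1"
  using row_sum[of 1 i] by (simp only: matpow_1)

lemma p_01: "\<omega> \<in> space M \<Longrightarrow> 0 \<le> p n l \<omega> \<and> p n l \<omega> \<le> 1"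
proof
  assume w: "\<omega> \<in> space M"
  show "0 \<le> p n l \<omega>" unfolding p_def using Z_01[OF w] P_nonneg by (intro sum_nonneg) simp
  have "p n l \<omega> \<le> (\<Sum>j\<in>UNIV. P $ l $ j * 1)"
    unfolding p_def using Z_01[OF w] P_nonneg by (intro sum_mono mult_left_mono) auto
  then show "p n l \<omega> \<le> 1" by (simp add: P_row_sum)
qed

lemma D_bound: "\<omega> \<in> space M \<Longrightarrow> \<bar>D n l \<omega>\<bar> \<le> 1"
  using X_0_1[of \<omega> n l] p_01[of \<omega> n l] unfolding D_def by linarith

lemma integrable_bounded:
  fixes f :: "'a \<Rightarrow> real"
  shows "f \<in> borel_measurable M \<Longrightarrow> (\<And>\<omega>. \<omega> \<in> space M \<Longrightarrow> \<bar>f \<omega>\<bar> \<le> C) \<Longrightarrow> integrable M f"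
  by (rule integrable_const_bound[of _ C]) auto

lemma integrable_mult_bounded:
  fixes f g :: "'a \<Rightarrow> real"
  assumes "f \<in> borel_measurable M" "g \<in> borel_measurable M"
    "\<And>\<omega>. \<omega> \<in> space M \<Longrightarrow> \<bar>f \<omega>\<bar> \<le> C" "\<And>\<omega>. \<omega> \<in> space M \<Longrightarrow> \<bar>g \<omega>\<bar> \<le> 1"
  shows "integrable M (\<lambda>\<omega>. f \<omega> * g \<omega>)"
proof (rule integrable_bounded[of _ "C"])
  fix \<omega> assume "\<omega> \<in> space M"
  then show "\<bar>f \<omega> * g \<omega>\<bar> \<le> C"
    using mult_mono[OF assms(3,4), of \<omega> \<omega>] assms(3)[of \<omega>] by (simp add: abs_mult)
qed (use assms in simp)

text \<open>Turns conditional probabilities into identities between integrals against bounded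
  functions of the past, the form in which they are used below.\<close>

lemma integral_cond_prob:
  assumes g: "g \<in> borel_measurable (F n)" and C: "\<And>\<omega>. \<omega> \<in> space M \<Longrightarrow> \<bar>g \<omega>\<bar> \<le> C"
    and E: "E \<in> sets M"
  shows "(\<integral>\<omega>. g \<omega> * indicator E \<omega> \<partial>M) = (\<integral>\<omega>. g \<omega> * cprob M (F n) E \<omega> \<partial>M)"
proof -
  interpret S: finite_measure_subalgebra M "F n"
    by unfold_locales (rule subalg)
  have "integrable M (\<lambda>\<omega>. g \<omega> * indicator E \<omega>)"
    by (rule integrable_mult_bounded[OF F_meas_M[OF g] _ C]) (use E in \<open>auto split: split_indicator\<close>)
  from S.real_cond_exp_intg(2)[OF this g] show ?thesis using E by (simp add: cprob_def)
qed

lemma X_eq_indicator: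
  "\<omega> \<in> space M \<Longrightarrow> X (Suc n) \<omega> $ l = indicator {\<omega>\<in>space M. X (Suc n) \<omega> $ l = 1} \<omega>"
  using X01[of \<omega> n l] by (auto split: split_indicator)

lemma cprob_meas: "cprob M (F n) E \<in> borel_measurable M"
  unfolding cprob_def by simp

lemma integral_X:
  assumes g: "g \<in> borel_measurable (F n)" and C: "\<And>\<omega>. \<omega> \<in> space M \<Longrightarrow> \<bar>g \<omega>\<bar> \<le> C"
  shows "(\<integral>\<omega>. g \<omega> * X (Suc n) \<omega> $ l \<partial>M) = (\<integral>\<omega>. g \<omega> * p n l \<omega> \<partial>M)"
proof -
  note [measurable] = F_meas_M[OF g] cprob_meas
  define E where "E = {\<omega>\<in>space M. X (Suc n) \<omega> $ l = 1}"
  have E: "E \<in> sets M" unfolding E_def by measurable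
  have "(\<integral>\<omega>. g \<omega> * X (Suc n) \<omega> $ l \<partial>M) = (\<integral>\<omega>. g \<omega> * indicator E \<omega> \<partial>M)"
    unfolding E_def by (intro Bochner_Integration.integral_cong refl) (simp only: X_eq_indicator[symmetric])
  also have "\<dots> = (\<integral>\<omega>. g \<omega> * cprob M (F n) E \<omega> \<partial>M)" by (rule integral_cond_prob[OF g C E])
  also have "\<dots> = (\<integral>\<omega>. g \<omega> * p n l \<omega> \<partial>M)"
  proof (rule integral_cong_AE)
    show "AE \<omega> in M. g \<omega> * cprob M (F n) E \<omega> = g \<omega> * p n l \<omega>"
      using cond[of n l] by (rule AE_mp) (simp add: E_def p_eq)
  qed measurable
  finally show ?thesis .
qed

lemma integral_D:
  assumes g: "g \<in> borel_measurable (F n)" and C: "\<And>\<omega>. \<omega> \<in> space M \<Longrightarrow> \<bar>g \<omega>\<bar> \<le> C"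
  shows "(\<integral>\<omega>. g \<omega> * D n l \<omega> \<partial>M) = 0"
proof -
  note [measurable] = F_meas_M[OF g]
  have "integrable M (\<lambda>\<omega>. g \<omega> * X (Suc n) \<omega> $ l)" "integrable M (\<lambda>\<omega>. g \<omega> * p n l \<omega>)"
    by (rule integrable_mult_bounded[OF _ _ C]; use X_0_1 p_01 in auto)+
  then show ?thesis using integral_X[OF g C, of l] by (simp add: D_def right_diff_distrib)
qed

text \<open>The product of two draws is the indicator that both are 1; conditional independence,
  taken for the pair and the value 1, factorises its conditional probability.\<close>

lemma integral_X_X:
  assumes "i \<noteq> j"
  shows "(\<integral>\<omega>. X (Suc n) \<omega> $ i * X (Suc n) \<omega> $ j \<partial>M) = (\<integral>\<omega>. p n i \<omega> * p n j \<omega> \<partial>M)"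
proof -
  note [measurable] = cprob_meas
  define E where "E l = {\<omega>\<in>space M. X (Suc n) \<omega> $ l = 1}" for l
  define E2 where "E2 = {\<omega>\<in>space M. \<forall>l\<in>{i, j}. X (Suc n) \<omega> $ l \<in> {1}}"
  have E2: "E2 \<in> sets M" unfolding E2_def by measurable
  have "AE \<omega> in M. cprob M (F n) E2 \<omega> =
          (\<Prod>l\<in>{i, j}. cprob M (F n) {\<omega>\<in>space M. X (Suc n) \<omega> $ l \<in> {1}} \<omega>)"
    using indep[of n] unfolding cond_indep_vars_def E2_def
    by (elim conjE allE[of _ "{i, j}"] impE) (auto dest!: bspec[of _ _ "\<lambda>_. {1}"])
  then have ae: "AE \<omega> in M. cprob M (F n) E2 \<omega> = p n i \<omega> * p n j \<omega>"
    using cond[of n i] cond[of n j] by eventually_elim (simp add: assms p_eq)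
  have "(\<integral>\<omega>. X (Suc n) \<omega> $ i * X (Suc n) \<omega> $ j \<partial>M) = (\<integral>\<omega>. 1 * indicator E2 \<omega> \<partial>M)"
  proof (intro Bochner_Integration.integral_cong refl)
    fix \<omega> assume "\<omega> \<in> space M"
    then show "X (Suc n) \<omega> $ i * X (Suc n) \<omega> $ j = 1 * indicator E2 \<omega>"
      using X01[of \<omega> n i] X01[of \<omega> n j] by (auto simp: E2_def split: split_indicator)
  qed
  also have "\<dots> = (\<integral>\<omega>. 1 * cprob M (F n) E2 \<omega> \<partial>M)"
    by (rule integral_cond_prob[OF _ _ E2, of _ _ 1]) auto
  also have "\<dots> = (\<integral>\<omega>. p n i \<omega> * p n j \<omega> \<partial>M)"
    by (rule integral_cong_AE) (use ae in auto)
  finally show ?thesis .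
qed

text \<open>After expansion all four terms have the integral of \<open>p n i * p n j\<close>, and
  their signs cancel.\<close>

lemma integral_D_D:
  assumes "i \<noteq> j"
  shows "(\<integral>\<omega>. D n i \<omega> * D n j \<omega> \<partial>M) = 0"
proof -
  have XX: "integrable M (\<lambda>\<omega>. X (Suc n) \<omega> $ i * X (Suc n) \<omega> $ j)"
    by (rule integrable_mult_bounded[of _ _ 1]) (use X_0_1 in auto)
  have pX: "integrable M (\<lambda>\<omega>. p n a \<omega> * X (Suc n) \<omega> $ b)" for a b
    by (rule integrable_mult_bounded[of _ _ 1]) (use X_0_1 p_01 in auto)
  have pp: "integrable M (\<lambda>\<omega>. p n i \<omega> * p n j \<omega>)"
    by (rule integrable_mult_bounded[of _ _ 1]) (use p_01 in auto)
  have pb: "\<bar>p n l \<omega>\<bar> \<le> 1" if "\<omega> \<in> space M" for l \<omega> using p_01[OF that, of n l] by simp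
  have "(\<integral>\<omega>. D n i \<omega> * D n j \<omega> \<partial>M) =
        (\<integral>\<omega>. X (Suc n) \<omega> $ i * X (Suc n) \<omega> $ j - p n j \<omega> * X (Suc n) \<omega> $ i -
             p n i \<omega> * X (Suc n) \<omega> $ j + p n i \<omega> * p n j \<omega> \<partial>M)"
    by (intro Bochner_Integration.integral_cong refl) (simp add: D_def algebra_simps)
  also have "\<dots> = (\<integral>\<omega>. X (Suc n) \<omega> $ i * X (Suc n) \<omega> $ j \<partial>M) - (\<integral>\<omega>. p n j \<omega> * X (Suc n) \<omega> $ i \<partial>M) -
             (\<integral>\<omega>. p n i \<omega> * X (Suc n) \<omega> $ j \<partial>M) + (\<integral>\<omega>. p n i \<omega> * p n j \<omega> \<partial>M)"
    using XX pX pp by simp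
  also have "\<dots> = 0"
    using integral_X[OF p_F pb, of j i] integral_X[OF p_F pb, of i j] integral_X_X[OF assms, of n]
    by (simp add: mult.commute)
  finally show ?thesis .
qed

text \<open>Stationarity of \<open>v\<close> removes the drift of the weighted mean, which makes
  this mean a martingale.\<close>

lemma v_p: "(\<Sum>l\<in>UNIV. v $ l * p n l \<omega>) = (\<Sum>l\<in>UNIV. v $ l * Z n \<omega> $ l)"
proof -
  have "(\<Sum>l\<in>UNIV. v $ l * p n l \<omega>) = (\<Sum>j\<in>UNIV. \<Sum>l\<in>UNIV. v $ l * (P $ l $ j * Z n \<omega> $ j))"
    unfolding p_def sum_distrib_left by (rule sum.swap)
  also have "\<dots> = (\<Sum>j\<in>UNIV. (v v* P) $ j * Z n \<omega> $ j)"
    by (simp add: vector_matrix_mult_def sum_distrib_left sum_distrib_right mult_ac)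
  finally show ?thesis by (simp add: v_stat)
qed

lemma Z_abs: "\<omega> \<in> space M \<Longrightarrow> \<bar>Z n \<omega> $ l\<bar> \<le> 1"
  using Z_01[of \<omega> n l] by simp

lemma X_abs: "\<omega> \<in> space M \<Longrightarrow> \<bar>X (Suc n) \<omega> $ l\<bar> \<le> 1"
  using X_0_1[of \<omega> n l] by simp

lemma mean_bound:
  assumes "\<omega> \<in> space M"
  shows "0 \<le> (\<Sum>l\<in>UNIV. v $ l * Z n \<omega> $ l) \<and> (\<Sum>l\<in>UNIV. v $ l * Z n \<omega> $ l) \<le> 1"
proof
  show "0 \<le> (\<Sum>l\<in>UNIV. v $ l * Z n \<omega> $ l)"
    using v_pos Z_01[OF assms] by (intro sum_nonneg) (simp add: less_imp_le)
  have "(\<Sum>l\<in>UNIV. v $ l * Z n \<omega> $ l) \<le> (\<Sum>l\<in>UNIV. v $ l * 1)"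
    using v_pos Z_01[OF assms] by (intro sum_mono mult_left_mono) (auto simp: less_imp_le)
  then show "(\<Sum>l\<in>UNIV. v $ l * Z n \<omega> $ l) \<le> 1" using v_sum by (simp add: inner_vec_def)
qed

text \<open>The weighted mean is a bounded martingale, so its increments are square summable in mean; by
  conditional independence this controls the noise at every node.\<close>

lemma noise_square_summable: "summable (\<lambda>n. \<integral>\<omega>. (r n * D n l \<omega>)\<^sup>2 \<partial>M)"
proof -
  define Y where "Y n \<omega> = (\<Sum>l\<in>UNIV. v $ l * Z n \<omega> $ l)" for n \<omega>
  define G where "G n \<omega> = (\<Sum>l\<in>UNIV. v $ l * D n l \<omega>)" for n \<omega>
  define y where "y n = (\<integral>\<omega>. (Y n \<omega>)\<^sup>2 \<partial>M)" for n
  have YF: "Y n \<in> borel_measurable (F n)" for n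
    unfolding Y_def by (intro borel_measurable_sum borel_measurable_times Z_F) simp
  have [measurable]: "Y n \<in> borel_measurable M" "G n \<in> borel_measurable M" for n
    using F_meas_M[OF YF] unfolding G_def by measurable
  have Y01: "0 \<le> Y n \<omega> \<and> Y n \<omega> \<le> 1" if "\<omega> \<in> space M" for n \<omega>
    using mean_bound[OF that] by (simp add: Y_def)
  then have Yb: "\<bar>Y n \<omega>\<bar> \<le> 1" if "\<omega> \<in> space M" for n \<omega> using that by fastforce
  \<comment> \<open>By \<open>v_p\<close> the weighted mean moves by weighted noise alone.\<close>
  have YS: "Y (Suc n) \<omega> = Y n \<omega> + r n * G n \<omega>" if "\<omega> \<in> space M" for n \<omega>
  proof -
    have "Y (Suc n) \<omega> = (1 - r n) * Y n \<omega> + r n * (\<Sum>l\<in>UNIV. v $ l * X (Suc n) \<omega> $ l)"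
      by (simp add: Y_def rec_nth[OF that] sum_distrib_left sum.distrib[symmetric] algebra_simps)
    moreover have "G n \<omega> = (\<Sum>l\<in>UNIV. v $ l * X (Suc n) \<omega> $ l) - Y n \<omega>"
      by (simp add: G_def D_def Y_def right_diff_distrib sum_subtractf v_p)
    ultimately show ?thesis by (simp only:) (simp add: algebra_simps)
  qed
  have iYD: "integrable M (\<lambda>\<omega>. Y n \<omega> * D n l \<omega>)" for n l
    by (rule integrable_mult_bounded[of _ _ 1]) (use Yb D_bound in auto)
  have iDD: "integrable M (\<lambda>\<omega>. D n i \<omega> * D n j \<omega>)" for n i j
    by (rule integrable_mult_bounded[of _ _ 1]) (use D_bound in auto)
  have YG: "Y n \<omega> * G n \<omega> = (\<Sum>l\<in>UNIV. v $ l * (Y n \<omega> * D n l \<omega>))" for n \<omega>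
    by (simp add: G_def sum_distrib_left mult_ac)
  have iYG: "integrable M (\<lambda>\<omega>. Y n \<omega> * G n \<omega>)" for n
    unfolding YG using iYD by simp
  have YG0: "(\<integral>\<omega>. Y n \<omega> * G n \<omega> \<partial>M) = 0" for n
    unfolding YG using iYD integral_D[OF YF Yb] by simp
  have GG: "(G n \<omega>)\<^sup>2 = (\<Sum>i\<in>UNIV. \<Sum>j\<in>UNIV. v $ i * v $ j * (D n i \<omega> * D n j \<omega>))" for n \<omega>
    by (simp add: G_def power2_eq_square sum_product mult_ac)
  have iGG: "integrable M (\<lambda>\<omega>. (G n \<omega>)\<^sup>2)" for n
    unfolding GG using iDD by simp
  have EGG: "(\<integral>\<omega>. (G n \<omega>)\<^sup>2 \<partial>M) = (\<Sum>i\<in>UNIV. (v $ i)\<^sup>2 * (\<integral>\<omega>. (D n i \<omega>)\<^sup>2 \<partial>M))" for n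
  proof -
    have "(\<integral>\<omega>. (G n \<omega>)\<^sup>2 \<partial>M) = (\<Sum>i\<in>UNIV. \<Sum>j\<in>UNIV. v $ i * v $ j * (\<integral>\<omega>. D n i \<omega> * D n j \<omega> \<partial>M))"
      unfolding GG using iDD by simp
    also have "\<dots> = (\<Sum>i\<in>UNIV. \<Sum>j\<in>UNIV. if j = i then (v $ i)\<^sup>2 * (\<integral>\<omega>. (D n i \<omega>)\<^sup>2 \<partial>M) else 0)"
      by (intro sum.cong refl) (auto simp: power2_eq_square integral_D_D)
    finally show ?thesis by simp
  qed
  \<comment> \<open>The noise at different nodes is uncorrelated, so the increment of the second
    moment \<open>y\<close> is a sum of nonnegative contributions of the nodes and dominates that of
    \<open>l\<close>. These increments telescope, and \<open>y\<close> stays in the unit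
    interval.\<close>
  have ED: "(v $ l)\<^sup>2 * (\<integral>\<omega>. (r n * D n l \<omega>)\<^sup>2 \<partial>M) \<le> y (Suc n) - y n" for n
  proof -
    have iY: "integrable M (\<lambda>\<omega>. (Y n \<omega>)\<^sup>2)"
      unfolding power2_eq_square by (rule integrable_mult_bounded[of _ _ 1]) (use Yb in auto)
    have "y (Suc n) = (\<integral>\<omega>. (Y n \<omega>)\<^sup>2 + 2 * r n * (Y n \<omega> * G n \<omega>) + (r n)\<^sup>2 * (G n \<omega>)\<^sup>2 \<partial>M)"
      unfolding y_def
      by (intro Bochner_Integration.integral_cong refl) (simp add: YS power2_eq_square algebra_simps)
    also have "\<dots> = y n + (r n)\<^sup>2 * (\<integral>\<omega>. (G n \<omega>)\<^sup>2 \<partial>M)"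
      using iY iYG iGG YG0 by (simp add: y_def)
    finally have "y (Suc n) - y n = (r n)\<^sup>2 * (\<integral>\<omega>. (G n \<omega>)\<^sup>2 \<partial>M)" by simp
    moreover have "(v $ l)\<^sup>2 * (\<integral>\<omega>. (D n l \<omega>)\<^sup>2 \<partial>M) \<le> (\<integral>\<omega>. (G n \<omega>)\<^sup>2 \<partial>M)"
      unfolding EGG by (rule member_le_sum) auto
    then have "(r n)\<^sup>2 * ((v $ l)\<^sup>2 * (\<integral>\<omega>. (D n l \<omega>)\<^sup>2 \<partial>M)) \<le> (r n)\<^sup>2 * (\<integral>\<omega>. (G n \<omega>)\<^sup>2 \<partial>M)"
      by (rule mult_left_mono) simp
    ultimately show ?thesis by (simp add: power_mult_distrib mult_ac)
  qed
  have y: "0 \<le> y n \<and> y n \<le> 1" for n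
  proof
    have "(\<integral>\<omega>. (Y n \<omega>)\<^sup>2 \<partial>M) \<le> (\<integral>\<omega>. 1 \<partial>M)"
    proof (rule integral_mono)
      show "integrable M (\<lambda>\<omega>. (Y n \<omega>)\<^sup>2)"
        unfolding power2_eq_square by (rule integrable_mult_bounded[of _ _ 1]) (use Yb in auto)
      show "(Y n \<omega>)\<^sup>2 \<le> 1" if "\<omega> \<in> space M" for \<omega>
        using Yb[OF that, of n] by (simp add: abs_square_le_1)
    qed simp
    then show "y n \<le> 1" by (simp add: y_def prob_space)
  qed (simp add: y_def)
  have "summable (\<lambda>n. (v $ l)\<^sup>2 * (\<integral>\<omega>. (r n * D n l \<omega>)\<^sup>2 \<partial>M))"
  proof (rule summableI_nonneg_bounded[of _ 1])
    fix n
    have "(\<Sum>i<n. (v $ l)\<^sup>2 * (\<integral>\<omega>. (r i * D i l \<omega>)\<^sup>2 \<partial>M)) \<le> (\<Sum>i<n. y (Suc i) - y i)"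
      by (intro sum_mono ED)
    also have "\<dots> = y n - y 0" by (rule sum_lessThan_telescope)
    also have "\<dots> \<le> 1" using y[of n] y[of 0] by linarith
    finally show "(\<Sum>i<n. (v $ l)\<^sup>2 * (\<integral>\<omega>. (r i * D i l \<omega>)\<^sup>2 \<partial>M)) \<le> 1" .
  qed simp
  then show ?thesis using v_pos[of l] by (subst (asm) summable_cmult_iff) simp
qed

lemma noise_AE_summable: "AE \<omega> in M. summable (\<lambda>n. r n * D n l \<omega>)"
proof -
  interpret O: orthogonal_increments M F "\<lambda>n \<omega>. r n * D n l \<omega>" 1
  proof
    show "subalgebra M (F n)" for n by (rule subalg)
    show "sets (F m) \<subseteq> sets (F n)" if "m \<le> n" for m n by (rule F_mono[OF that])
    show "(\<lambda>\<omega>. r n * D n l \<omega>) \<in> borel_measurable (F (Suc n))" for n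
      by (intro borel_measurable_times D_F) simp
    show "\<bar>r n * D n l \<omega>\<bar> \<le> 1" if "\<omega> \<in> space M" for \<omega> n
      using mult_mono[of "\<bar>r n\<bar>" 1 "\<bar>D n l \<omega>\<bar>" 1] r[of n] D_bound[OF that, of n l]
      by (simp add: abs_mult)
    fix g :: "'a \<Rightarrow> real" and n C assume g: "g \<in> borel_measurable (F n)" "\<And>\<omega>. \<omega> \<in> space M \<Longrightarrow> \<bar>g \<omega>\<bar> \<le> C"
    have "(\<integral>\<omega>. g \<omega> * (r n * D n l \<omega>) \<partial>M) = (\<integral>\<omega>. r n * (g \<omega> * D n l \<omega>) \<partial>M)"
      by (simp add: mult_ac)
    also have "\<dots> = r n * (\<integral>\<omega>. g \<omega> * D n l \<omega> \<partial>M)" by (rule integral_mult_right_zero)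
    finally show "(\<integral>\<omega>. g \<omega> * (r n * D n l \<omega>) \<partial>M) = 0" by (simp add: integral_D[OF g])
  qed
  show ?thesis by (rule O.AE_summable[OF noise_square_summable])
qed

section \<open>Divergent step sums: the oscillation vanishes pathwise\<close>

lemma AE_osc_tendsto_0:
  assumes div: "filterlim (\<lambda>n. \<Sum>k<n. r k) at_top sequentially"
  shows "AE \<omega> in M. (\<lambda>n. osc cls (Z n \<omega>)) \<longlonglongrightarrow> 0"
proof -
  have "AE \<omega> in M. \<forall>l. summable (\<lambda>n. r n * D n l \<omega>)"
    unfolding AE_all_countable using noise_AE_summable by blast
  then show ?thesis
  proof (rule AE_mp, intro AE_I2 impI)
    fix \<omega> assume \<omega>: "\<omega> \<in> space M" and s: "\<forall>l. summable (\<lambda>n. r n * D n l \<omega>)"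
    show "(\<lambda>n. osc cls (Z n \<omega>)) \<longlonglongrightarrow> 0"
    proof (rule relaxation_oscillation_tendsto_0[OF r div])
      show "Z (Suc n) \<omega> = (1 - r n) *\<^sub>R Z n \<omega> + r n *\<^sub>R (P *v Z n \<omega>) + (\<chi> l. r n * D n l \<omega>)" for n
        by (simp add: vec_eq_iff rec_nth[OF \<omega>] p_eq D_def algebra_simps)
      show "summable (\<lambda>n. \<chi> l. r n * D n l \<omega>)" by (rule summable_vec) (use s in simp)
    qed
  qed
qed

section \<open>Summable steps: a vanishing oscillation forces an extreme start\<close>

lemma AE_zero_of_square:
  fixes g :: "'a \<Rightarrow> real"
  assumes "g \<in> borel_measurable M" "\<And>\<omega>. \<omega> \<in> space M \<Longrightarrow> \<bar>g \<omega>\<bar> \<le> 1"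
    and "(\<integral>\<omega>. g \<omega> * g \<omega> \<partial>M) = 0"
  shows "AE \<omega> in M. g \<omega> = 0"
proof -
  have "integrable M (\<lambda>\<omega>. g \<omega> * g \<omega>)" by (rule integrable_mult_bounded[of _ _ 1]) (use assms in auto)
  then have "AE \<omega> in M. g \<omega> * g \<omega> = 0"
    using integral_nonneg_eq_0_iff_AE[of M "\<lambda>\<omega>. g \<omega> * g \<omega>"] assms(3) by simp
  then show ?thesis by eventually_elim simp
qed

text \<open>Dominated convergence applies to each of the finitely many pairs of nodes, and the sum
  of the gaps over all pairs bounds the oscillation. It carries the almost sure limit over to the
  weighted means.\<close>

lemma integral_weighted_oscillation_tendsto_0:
  assumes lim: "AE \<omega> in M. (\<lambda>n. osc cls (Z n \<omega>)) \<longlonglongrightarrow> 0"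
    and g: "(g :: 'a \<Rightarrow> real) \<in> borel_measurable M" and gb: "\<And>\<omega>. \<omega> \<in> space M \<Longrightarrow> \<bar>g \<omega>\<bar> \<le> 1"
  shows "(\<lambda>n. osc cls (\<chi> l. \<integral>\<omega>. g \<omega> * Z n \<omega> $ l \<partial>M)) \<longlonglongrightarrow> 0"
proof -
  note [measurable] = g
  define y where "y n = (\<chi> l. \<integral>\<omega>. g \<omega> * Z n \<omega> $ l \<partial>M)" for n
  have int: "integrable M (\<lambda>\<omega>. g \<omega> * Z n \<omega> $ l)" for n l
    by (rule integrable_mult_bounded[of _ _ 1]) (use gb Z_abs in auto)
  have diff: "(\<lambda>n. y n $ i - y n $ j) \<longlonglongrightarrow> 0" if ij: "cls i = cls j" for i j
  proof -
    have "(\<lambda>n. \<integral>\<omega>. g \<omega> * Z n \<omega> $ i - g \<omega> * Z n \<omega> $ j \<partial>M) \<longlonglongrightarrow> (\<integral>\<omega>. 0 \<partial>M)"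
    proof (rule integral_dominated_convergence[where w = "\<lambda>_. 1"])
      show "AE \<omega> in M. (\<lambda>n. g \<omega> * Z n \<omega> $ i - g \<omega> * Z n \<omega> $ j) \<longlonglongrightarrow> 0"
        using lim
      proof eventually_elim
        case (elim \<omega>)
        have "(\<lambda>n. Z n \<omega> $ i - Z n \<omega> $ j) \<longlonglongrightarrow> 0"
          by (rule Lim_null_comparison[OF _ elim]) (simp add: osc_ge[OF ij])
        then have "(\<lambda>n. g \<omega> * (Z n \<omega> $ i - Z n \<omega> $ j)) \<longlonglongrightarrow> 0"
          by (rule tendsto_mult_right_zero)
        then show ?case by (simp add: right_diff_distrib)
      qed
      fix n
      have "\<bar>g \<omega>\<bar> * \<bar>Z n \<omega> $ i - Z n \<omega> $ j\<bar> \<le> 1" if "\<omega> \<in> space M" for \<omega>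
      proof -
        have "\<bar>Z n \<omega> $ i - Z n \<omega> $ j\<bar> \<le> 1"
          using Z_01[OF that, of n i] Z_01[OF that, of n j] by linarith
        then show ?thesis using mult_mono[OF gb[OF that], of _ 1] by simp
      qed
      then show "AE \<omega> in M. norm (g \<omega> * Z n \<omega> $ i - g \<omega> * Z n \<omega> $ j) \<le> 1"
        by (intro AE_I2) (simp add: right_diff_distrib[symmetric] abs_mult)
    qed auto
    then show ?thesis using int by (simp add: y_def)
  qed
  have "osc cls (y n) \<le> (\<Sum>(i, j)\<in>{(i, j). cls i = cls j}. \<bar>y n $ i - y n $ j\<bar>)" for n
  proof (rule osc_le)
    fix i j assume "cls i = cls j"
    then show "\<bar>y n $ i - y n $ j\<bar> \<le> (\<Sum>(i, j)\<in>{(i, j). cls i = cls j}. \<bar>y n $ i - y n $ j\<bar>)"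
      using member_le_sum[of "(i, j)" "{(i, j). cls i = cls j}" "\<lambda>(i, j). \<bar>y n $ i - y n $ j\<bar>"] by auto
  qed
  moreover have "(\<lambda>n. \<Sum>(i, j)\<in>{(i, j). cls i = cls j}. \<bar>y n $ i - y n $ j\<bar>) \<longlonglongrightarrow> 0"
    by (rule tendsto_null_sum) (use diff in \<open>auto intro!: tendsto_rabs_zero\<close>)
  ultimately have "(\<lambda>n. osc cls (y n)) \<longlonglongrightarrow> 0"
    by (intro Lim_null_comparison[of "\<lambda>n. osc cls (y n)"]) (auto simp: osc_nonneg)
  then show ?thesis by (simp only: y_def)
qed

text \<open>Against a weight from the past, the mean evolves by the noiseless recursion, which cannot
  bring a positive oscillation to \<open>0\<close> when the steps are summable.\<close>

lemma AE_class_constant: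
  assumes summ: "summable r" and small: "\<And>k. n \<le> k \<Longrightarrow> r k \<le> 1 / 4"
    and lim: "AE \<omega> in M. (\<lambda>n. osc cls (Z n \<omega>)) \<longlonglongrightarrow> 0"
    and ij: "cls i = cls j"
  shows "AE \<omega> in M. Z n \<omega> $ i = Z n \<omega> $ j"
proof -
  \<comment> \<open>The weight is the gap itself, so that \<open>y n $ i - y n $ j\<close> is the
    mean of its square.\<close>
  define g where "g \<omega> = Z n \<omega> $ i - Z n \<omega> $ j" for \<omega>
  have gF: "g \<in> borel_measurable (F n)" unfolding g_def by (intro borel_measurable_diff Z_F)
  note [measurable] = F_meas_M[OF gF]
  have gb: "\<bar>g \<omega>\<bar> \<le> 1" if "\<omega> \<in> space M" for \<omega>
    using Z_01[OF that, of n i] Z_01[OF that, of n j] unfolding g_def by linarith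
  define y where "y k = (\<chi> l. \<integral>\<omega>. g \<omega> * Z k \<omega> $ l \<partial>M)" for k
  have int: "integrable M (\<lambda>\<omega>. g \<omega> * Z k \<omega> $ l)" for k l
    by (rule integrable_mult_bounded[of _ _ 1]) (use gb Z_abs in auto)
  have intX: "integrable M (\<lambda>\<omega>. g \<omega> * X (Suc k) \<omega> $ l)" for k l
    by (rule integrable_mult_bounded[of _ _ 1]) (use gb X_abs in auto)
  have rec_y: "y (Suc k) = (1 - r k) *\<^sub>R y k + r k *\<^sub>R (P *v y k)" if k: "n \<le> k" for k
  proof -
    have "(\<integral>\<omega>. g \<omega> * Z (Suc k) \<omega> $ l \<partial>M) =
          (1 - r k) * (\<integral>\<omega>. g \<omega> * Z k \<omega> $ l \<partial>M) + r k * (P *v y k) $ l" for l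
    proof -
      have "(\<integral>\<omega>. g \<omega> * Z (Suc k) \<omega> $ l \<partial>M) =
            (\<integral>\<omega>. (1 - r k) * (g \<omega> * Z k \<omega> $ l) + r k * (g \<omega> * X (Suc k) \<omega> $ l) \<partial>M)"
        by (intro Bochner_Integration.integral_cong refl) (simp add: rec_nth algebra_simps)
      also have "\<dots> = (1 - r k) * (\<integral>\<omega>. g \<omega> * Z k \<omega> $ l \<partial>M) + r k * (\<integral>\<omega>. g \<omega> * X (Suc k) \<omega> $ l \<partial>M)"
        using int intX by simp
      also have "(\<integral>\<omega>. g \<omega> * X (Suc k) \<omega> $ l \<partial>M) = (\<integral>\<omega>. g \<omega> * p k l \<omega> \<partial>M)"
        by (rule integral_X[OF F_meas_mono[OF gF k] gb])
      also have "\<dots> = (\<integral>\<omega>. (\<Sum>m\<in>UNIV. P $ l $ m * (g \<omega> * Z k \<omega> $ m)) \<partial>M)"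
        by (simp add: p_def sum_distrib_left mult_ac)
      also have "\<dots> = (P *v y k) $ l"
        using int by (simp add: y_def matrix_vector_mult_def)
      finally show ?thesis .
    qed
    then show ?thesis by (simp add: y_def vec_eq_iff)
  qed
  have "osc cls (y n) = 0"
    by (rule relaxation_oscillation_eq_0[OF r summ rec_y small])
       (use integral_weighted_oscillation_tendsto_0[OF lim F_meas_M[OF gF] gb] in \<open>auto simp: y_def\<close>)
  then have "y n $ i - y n $ j = 0" using osc_ge[OF ij, of "y n"] by simp
  then have "(\<integral>\<omega>. g \<omega> * Z n \<omega> $ i - g \<omega> * Z n \<omega> $ j \<partial>M) = 0" using int by (simp add: y_def)
  then have "(\<integral>\<omega>. g \<omega> * g \<omega> \<partial>M) = 0" by (simp add: g_def right_diff_distrib)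
  then have "AE \<omega> in M. g \<omega> = 0" by (intro AE_zero_of_square) (use gb in auto)
  then show ?thesis by (simp add: g_def)
qed

text \<open>All successors of \<open>i\<close> lie in one class, where \<open>Z n\<close> is almost
  surely constant, so the average that defines \<open>p n i\<close> equals the value at any of
  them.\<close>

lemma AE_p_eq_Z:
  assumes const: "\<And>i j. cls i = cls j \<Longrightarrow> AE \<omega> in M. Z n \<omega> $ i = Z n \<omega> $ j"
    and ij: "0 < P $ i $ j"
  shows "AE \<omega> in M. p n i \<omega> = Z n \<omega> $ j"
proof -
  have "AE \<omega> in M. \<forall>k. 0 < P $ i $ k \<longrightarrow> Z n \<omega> $ k = Z n \<omega> $ j"
    unfolding AE_all_countable
  proof
    fix k
    show "AE \<omega> in M. 0 < P $ i $ k \<longrightarrow> Z n \<omega> $ k = Z n \<omega> $ j"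
    proof (cases "0 < P $ i $ k")
      case True
      have "0 < matpow P 1 $ i $ k" "0 < matpow P 1 $ i $ j" unfolding matpow_1 by fact+
      then have "cls k = cls j" by (rule cls_matpow) simp
      then show ?thesis using const by simp
    qed simp
  qed
  then show ?thesis
  proof eventually_elim
    case (elim \<omega>)
    have "p n i \<omega> = (\<Sum>k\<in>UNIV. P $ i $ k * Z n \<omega> $ j)"
      unfolding p_def
    proof (intro sum.cong refl)
      fix k show "P $ i $ k * Z n \<omega> $ k = P $ i $ k * Z n \<omega> $ j"
        using elim P_nonneg[of i k] by (cases "P $ i $ k = 0") (auto simp: less_le)
    qed
    then show ?case by (simp add: sum_distrib_right[symmetric] P_row_sum)
  qed
qed

lemma P_pos_next: "\<exists>j. 0 < P $ i $ j"
  using row_pos[of 1 i] by (simp only: matpow_1)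

text \<open>If the classes stay constant, two distinct nodes of one class always draw the same value although
  the draws are independent, so the draws are deterministic.\<close>

lemma AE_extreme:
  assumes const: "\<And>n i j. n0 \<le> n \<Longrightarrow> cls i = cls j \<Longrightarrow> AE \<omega> in M. Z n \<omega> $ i = Z n \<omega> $ j"
    and ab: "a \<noteq> b" "cls a = cls b" and j: "0 < P $ a $ j" and n: "n0 \<le> n"
  shows "AE \<omega> in M. Z n \<omega> $ j \<in> {0, 1}"
proof -
  obtain j' where j': "0 < P $ b $ j'" using P_pos_next by blast
  have "cls j = cls j'"
    by (rule cls_matpow[of 1 a j b j']) (use j j' ab in \<open>simp_all only: matpow_1\<close>)
  then have jj: "AE \<omega> in M. Z n \<omega> $ j = Z n \<omega> $ j'" by (rule const[OF n])
  have pa: "AE \<omega> in M. p n a \<omega> = Z n \<omega> $ j" by (rule AE_p_eq_Z[OF const[OF n] j])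
  have pb: "AE \<omega> in M. p n b \<omega> = Z n \<omega> $ j'" by (rule AE_p_eq_Z[OF const[OF n] j'])
  have "AE \<omega> in M. Z n \<omega> $ a = Z n \<omega> $ b" "AE \<omega> in M. Z (Suc n) \<omega> $ a = Z (Suc n) \<omega> $ b"
    using const[OF _ ab(2)] n by simp_all
  then have XX: "AE \<omega> in M. X (Suc n) \<omega> $ a = X (Suc n) \<omega> $ b"
    using AE_space
  proof eventually_elim
    case (elim \<omega>)
    then have "r n * X (Suc n) \<omega> $ a = r n * X (Suc n) \<omega> $ b"
      using rec_nth[of \<omega> n a] rec_nth[of \<omega> n b] by simp
    then show ?case using r[of n] by simp
  qed
  have iZ: "integrable M (\<lambda>\<omega>. Z n \<omega> $ j)"
    by (rule integrable_bounded[of _ 1]) (use Z_01 in auto)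
  have iZZ: "integrable M (\<lambda>\<omega>. Z n \<omega> $ j * Z n \<omega> $ j)"
    by (rule integrable_mult_bounded[of _ _ 1]) (use Z_01 in auto)
  \<comment> \<open>Independence makes this the mean of the product of the two draws; as they
    coincide and are 0 or 1, it is also the mean of one draw, that is, of \<open>Z n\<close> at
    \<open>j\<close>. Hence \<open>Z n * (1 - Z n)\<close> at \<open>j\<close> has mean 0.\<close>
  have "(\<integral>\<omega>. Z n \<omega> $ j * Z n \<omega> $ j \<partial>M) = (\<integral>\<omega>. p n a \<omega> * p n b \<omega> \<partial>M)"
  proof (rule integral_cong_AE)
    show "AE \<omega> in M. Z n \<omega> $ j * Z n \<omega> $ j = p n a \<omega> * p n b \<omega>"
      using pa pb jj by eventually_elim simp
  qed measurable
  also have "\<dots> = (\<integral>\<omega>. X (Suc n) \<omega> $ a * X (Suc n) \<omega> $ b \<partial>M)"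
    by (rule integral_X_X[OF ab(1), symmetric])
  also have "\<dots> = (\<integral>\<omega>. 1 * X (Suc n) \<omega> $ a \<partial>M)"
  proof (rule integral_cong_AE)
    show "AE \<omega> in M. X (Suc n) \<omega> $ a * X (Suc n) \<omega> $ b = 1 * X (Suc n) \<omega> $ a"
      using XX AE_space
    proof eventually_elim
      case (elim \<omega>)
      then show ?case using X01[of \<omega> n a] by auto
    qed
  qed measurable
  also have "\<dots> = (\<integral>\<omega>. 1 * p n a \<omega> \<partial>M)" by (rule integral_X[of _ _ 1]) auto
  also have "\<dots> = (\<integral>\<omega>. Z n \<omega> $ j \<partial>M)"
    by (rule integral_cong_AE) (use pa in auto)
  finally have "(\<integral>\<omega>. Z n \<omega> $ j - Z n \<omega> $ j * Z n \<omega> $ j \<partial>M) = 0" using iZ iZZ by simp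
  moreover have "AE \<omega> in M. 0 \<le> Z n \<omega> $ j - Z n \<omega> $ j * Z n \<omega> $ j"
    using Z_01 by (intro AE_I2) (simp add: mult_left_le)
  ultimately have "AE \<omega> in M. Z n \<omega> $ j - Z n \<omega> $ j * Z n \<omega> $ j = 0"
    using integral_nonneg_eq_0_iff_AE[of M "\<lambda>\<omega>. Z n \<omega> $ j - Z n \<omega> $ j * Z n \<omega> $ j"] iZ iZZ by simp
  then show ?thesis by eventually_elim (auto simp: algebra_simps)
qed

text \<open>A node that stays in \<open>{0, 1}\<close> must draw its own value, so its successors agree with it.\<close>

lemma AE_extreme_next:
  assumes const: "\<And>i j. cls i = cls j \<Longrightarrow> AE \<omega> in M. Z n \<omega> $ i = Z n \<omega> $ j"
    and ext: "AE \<omega> in M. Z n \<omega> $ i \<in> {0, 1}" "AE \<omega> in M. Z (Suc n) \<omega> $ i \<in> {0, 1}"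
    and ij: "0 < P $ i $ j"
  shows "AE \<omega> in M. Z n \<omega> $ j = Z n \<omega> $ i"
proof -
  \<comment> \<open>A draw different from the present value would put the next value strictly
    between 0 and 1.\<close>
  have XZ: "AE \<omega> in M. X (Suc n) \<omega> $ i = Z n \<omega> $ i"
    using ext AE_space
  proof eventually_elim
    case (elim \<omega>)
    then show ?case using rec_nth[of \<omega> n i] X01[of \<omega> n i] r[of n] by auto
  qed
  define g where "g \<omega> = Z n \<omega> $ i - p n i \<omega>" for \<omega>
  have gF: "g \<in> borel_measurable (F n)" unfolding g_def by (intro borel_measurable_diff Z_F p_F)
  note [measurable] = F_meas_M[OF gF]
  have gb: "\<bar>g \<omega>\<bar> \<le> 1" if "\<omega> \<in> space M" for \<omega>
    using Z_01[OF that, of n i] p_01[OF that, of n i] unfolding g_def by linarith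
  \<comment> \<open>By \<open>XZ\<close> the noise \<open>D n i\<close> coincides with
    \<open>g\<close>, which is already known at time \<open>n\<close> and therefore orthogonal to
    it.\<close>
  have "(\<integral>\<omega>. g \<omega> * g \<omega> \<partial>M) = (\<integral>\<omega>. g \<omega> * D n i \<omega> \<partial>M)"
    by (rule integral_cong_AE) (use XZ in \<open>auto simp: D_def g_def elim!: eventually_mono\<close>)
  also have "\<dots> = 0" by (rule integral_D[OF gF gb])
  finally have "AE \<omega> in M. g \<omega> = 0" by (intro AE_zero_of_square) (use gb in auto)
  moreover have "AE \<omega> in M. p n i \<omega> = Z n \<omega> $ j" by (rule AE_p_eq_Z[OF const ij])
  ultimately show ?thesis by eventually_elim (simp add: g_def)
qed

text \<open>Induction along the path. Since \<open>AE_extreme_next\<close> looks at two consecutive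
  times, what passes from node to node is extremeness at all times from \<open>n0\<close>
  on.\<close>

lemma AE_extreme_path:
  assumes const: "\<And>n i j. n0 \<le> n \<Longrightarrow> cls i = cls j \<Longrightarrow> AE \<omega> in M. Z n \<omega> $ i = Z n \<omega> $ j"
    and ext: "\<And>n. n0 \<le> n \<Longrightarrow> AE \<omega> in M. Z n \<omega> $ i \<in> {0, 1}"
    and path: "0 < matpow P k $ i $ j" and n: "n0 \<le> n"
  shows "AE \<omega> in M. Z n \<omega> $ j = Z n \<omega> $ i"
  using ext path n
proof (induction k arbitrary: i n)
  case 0
  then show ?case by (auto simp: matpow_0 mat_def split: if_splits)
next
  case (Suc k)
  obtain m where m: "0 < P $ i $ m" "0 < matpow P k $ m $ j"
    using Suc.prems(2) nonneg by (auto simp: matpow_Suc matrix_mult_pos_iff nonneg_matpow)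
  have eq: "AE \<omega> in M. Z n \<omega> $ m = Z n \<omega> $ i" if "n0 \<le> n" for n
    by (rule AE_extreme_next[OF const[OF that] Suc.prems(1)[OF that] Suc.prems(1) m(1)]) (use that in auto)
  have "AE \<omega> in M. Z n \<omega> $ m \<in> {0, 1}" if "n0 \<le> n" for n
    using eq[OF that] Suc.prems(1)[OF that] by eventually_elim simp
  then have "AE \<omega> in M. Z n \<omega> $ j = Z n \<omega> $ m" by (rule Suc.IH[OF _ m(2) Suc.prems(3)])
  with eq[OF Suc.prems(3)] show ?case by eventually_elim simp
qed

text \<open>0 and 1 are the extreme points of the unit interval: a convex combination with positive
  weights equals one of them only if both terms do.\<close>

lemma extreme_backwards:
  assumes "\<omega> \<in> space M" "Z n \<omega> = c" "c = 0 \<or> c = 1"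
  shows "Z 0 \<omega> = c"
  using assms(2)
proof (induction n)
  case (Suc n)
  have "Z n \<omega> $ l = c $ l" for l
  proof -
    have e: "(1 - r n) * Z n \<omega> $ l + r n * X (Suc n) \<omega> $ l = c $ l"
      using Suc.prems rec_nth[OF assms(1), of n l] by simp
    have nn: "0 \<le> (1 - r n) * Z n \<omega> $ l" "0 \<le> r n * X (Suc n) \<omega> $ l"
        "0 \<le> (1 - r n) * (1 - Z n \<omega> $ l)" "0 \<le> r n * (1 - X (Suc n) \<omega> $ l)"
      using Z_01[OF assms(1), of n l] X_0_1[OF assms(1), of n l] r[of n] by simp_all
    from assms(3) show ?thesis
    proof
      assume c: "c = 0"
      then have "(1 - r n) * Z n \<omega> $ l = 0" using e nn(1,2) unfolding c zero_index by linarith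
      then show ?thesis using r[of n] c by simp
    next
      assume c: "c = 1"
      then have "(1 - r n) * (1 - Z n \<omega> $ l) + r n * (1 - X (Suc n) \<omega> $ l) = 0"
        using e by (simp add: algebra_simps)
      then have "(1 - r n) * (1 - Z n \<omega> $ l) = 0" using nn(3,4) by linarith
      then show ?thesis using r[of n] c by simp
    qed
  qed
  then show ?case by (intro Suc.IH) (simp add: vec_eq_iff)
qed simp

lemma summable_imp_initial_extreme:
  assumes summ: "summable r" and lim: "AE \<omega> in M. (\<lambda>n. osc cls (Z n \<omega>)) \<longlonglongrightarrow> 0"
    and ab: "a \<noteq> b" "cls a = cls b"
  shows "AE \<omega> in M. Z 0 \<omega> = 0 \<or> Z 0 \<omega> = 1"
proof -
  have "\<forall>\<^sub>F n in sequentially. r n < 1 / 4"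
    by (rule order_tendstoD(2)[OF summable_LIMSEQ_zero[OF summ]]) simp
  then have "\<forall>\<^sub>F n in sequentially. r n \<le> 1 / 4" by eventually_elim simp
  then obtain n0 where n0: "\<And>n. n0 \<le> n \<Longrightarrow> r n \<le> 1 / 4"
    unfolding eventually_sequentially by blast
  have const: "AE \<omega> in M. Z n \<omega> $ i = Z n \<omega> $ j" if "n0 \<le> n" "cls i = cls j" for n i j
    by (rule AE_class_constant[OF summ _ lim that(2)]) (use n0 that(1) in auto)
  obtain j where j: "0 < P $ a $ j" using P_pos_next by blast
  have ext: "AE \<omega> in M. Z n \<omega> $ j \<in> {0, 1}" if "n0 \<le> n" for n
    by (rule AE_extreme[OF const ab j that])
  have "AE \<omega> in M. \<forall>i. Z n0 \<omega> $ i = Z n0 \<omega> $ j"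
    unfolding AE_all_countable
  proof
    fix i
    obtain k where k: "0 < matpow P k $ j $ i" by (rule irreducible_matE[OF irred])
    show "AE \<omega> in M. Z n0 \<omega> $ i = Z n0 \<omega> $ j"
      by (rule AE_extreme_path[OF const ext k order_refl])
  qed
  then show ?thesis using ext[OF order_refl] AE_space
  proof eventually_elim
    case (elim \<omega>)
    then have "Z n0 \<omega> = 0 \<or> Z n0 \<omega> = 1" by (auto simp: vec_eq_iff)
    then show ?case using extreme_backwards[OF elim(3), of n0] by blast
  qed
qed

lemma initial_extreme_prob:
  assumes "AE \<omega> in M. Z 0 \<omega> = 0 \<or> Z 0 \<omega> = 1"
  shows "1 \<le> measure M {\<omega>\<in>space M. Z 0 \<omega> = 0} + measure M {\<omega>\<in>space M. Z 0 \<omega> = 1}"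
proof -
  note [measurable] = Z0
  have "prob ({\<omega>\<in>space M. Z 0 \<omega> = 0} \<union> {\<omega>\<in>space M. Z 0 \<omega> = 1}) = 1"
    by (subst prob_eq_1) (use assms in \<open>auto elim!: AE_mp\<close>)
  then show ?thesis
    using measure_Un_le[of "{\<omega>\<in>space M. Z 0 \<omega> = 0}" M "{\<omega>\<in>space M. Z 0 \<omega> = 1}"] by simp
qed

end

theorem theorem2p2:
  fixes M :: "'a measure"
    and W :: "real ^ 'n ^ 'n"
    and r :: "nat \<Rightarrow> real"
    and Z X :: "nat \<Rightarrow> 'a \<Rightarrow> real ^ 'n"
    and v :: "real ^ 'n"
    and cls :: "'n \<Rightarrow> nat"
  assumes "prob_space M"
    and "CARD('n) \<ge> 2"
    and "nonneg_mat W" and "irreducible_mat W" and "transpose W *v 1 = 1"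
    and "\<And>n. 0 < r n \<and> r n < 1"
    and "Z 0 \<in> borel_measurable M"
    and "\<And>\<omega> l. \<omega> \<in> space M \<Longrightarrow> Z 0 \<omega> $ l \<in> {0..1}"
    and "measure M {\<omega>\<in>space M. Z 0 \<omega> = 0} + measure M {\<omega>\<in>space M. Z 0 \<omega> = 1} < 1"
    and "\<And>n. X (Suc n) \<in> borel_measurable M"
    and "\<And>n \<omega> l. \<omega> \<in> space M \<Longrightarrow> X (Suc n) \<omega> $ l \<in> {0, 1}"
    and "\<And>n. cond_indep_vars M (hist_algebra M Z X n) (\<lambda>_. borel) (\<lambda>l \<omega>. X (Suc n) \<omega> $ l) UNIV"
    and "\<And>n l. AE \<omega> in M. cprob M (hist_algebra M Z X n) {\<omega>\<in>space M. X (Suc n) \<omega> $ l = 1} \<omega> =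
                           (transpose W *v Z n \<omega>) $ l"
    and "\<And>n \<omega>. \<omega> \<in> space M \<Longrightarrow> Z (Suc n) \<omega> = (1 - r n) *\<^sub>R Z n \<omega> + r n *\<^sub>R X (Suc n) \<omega>"
    and "\<And>l. 0 < v $ l" and "v v* transpose W = v" and "v \<bullet> 1 = 1"
    and "cyclic_classes (transpose W) cls"
  shows "(period (transpose W) = CARD('n) \<longrightarrow>
            (\<forall>n. \<forall>\<omega>\<in>space M. Zpart3 cls v (Z n \<omega>) = 0)) \<and>
         (period (transpose W) < CARD('n) \<longrightarrow>
            ((AE \<omega> in M. (\<lambda>n. Zpart3 cls v (Z n \<omega>)) \<longlonglongrightarrow> 0) \<longleftrightarrow>
             filterlim (\<lambda>n. \<Sum>k<n. r k) at_top sequentially))"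
proof (intro conjI impI)
  define P where "P = transpose W"
  interpret prob_space M by fact
  interpret chain: cyclic_chain P cls
  proof
    show "nonneg_mat P" using assms(3) by (simp add: P_def nonneg_mat_def transpose_def)
    show "irreducible_mat P"
      using assms(4) unfolding P_def irreducible_mat_def matpow_transpose by (simp add: transpose_def)
  qed (use assms in \<open>simp_all add: P_def\<close>)
  interpret reinforced_network M P cls r Z X v
    by unfold_locales (use assms in \<open>simp_all add: P_def\<close>)
  {
    assume per: "period (transpose W) = CARD('n)"
    \<comment> \<open>As many classes as nodes: every class is a singleton, and its average is the
      value at its node.\<close>
    have "range cls = {0..<CARD('n)}" using chain.cyc per by (simp add: cyclic_classes_def P_def)
    then have "inj cls" by (intro eq_card_imp_inj_on) auto
    then have "{j. cls j = cls l} = {l}" for l by (auto dest: injD)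
    then have "Zclass cls v z = z" for z
      using v_pos by (simp add: Zclass_def vec_eq_iff less_imp_neq[symmetric])
    then show "\<forall>n. \<forall>\<omega>\<in>space M. Zpart3 cls v (Z n \<omega>) = 0" by (simp add: Zpart3_eq)
  next
    assume per: "period (transpose W) < CARD('n)"
    have "range cls = {0..<period (transpose W)}"
      using chain.cyc by (simp add: cyclic_classes_def P_def)
    \<comment> \<open>Pigeonhole: some class contains two distinct nodes, whose independent draws
      drive the converse.\<close>
    then have "card (range cls) < CARD('n)" using per by simp
    then obtain a b where ab: "a \<noteq> b" "cls a = cls b"
      using card_image[of cls UNIV] unfolding inj_on_def by fastforce
    show "(AE \<omega> in M. (\<lambda>n. Zpart3 cls v (Z n \<omega>)) \<longlonglongrightarrow> 0) \<longleftrightarrow>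
          filterlim (\<lambda>n. \<Sum>k<n. r k) at_top sequentially"
      unfolding Zpart3_tendsto_0_iff[OF v_pos]
    proof
      assume lim: "AE \<omega> in M. (\<lambda>n. osc cls (Z n \<omega>)) \<longlonglongrightarrow> 0"
      have "\<not> summable r"
      proof
        assume "summable r"
        \<comment> \<open>An almost surely extreme start contradicts the assumption that the
          probabilities of starting at 0 and at 1 sum to less than 1.\<close>
        from initial_extreme_prob[OF summable_imp_initial_extreme[OF this lim ab]] assms(9)
        show False by simp
      qed
      then show "filterlim (\<lambda>n. \<Sum>k<n. r k) at_top sequentially"
        using r by (subst sum_at_top_iff_not_summable) (auto simp: less_imp_le)
    qed (rule AE_osc_tendsto_0)
  }
qed

end
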